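(* Under the assumptions of Theorem 3 (asynchronous bandit unichain and strictly indexable; the unique fixed point $\mathbf m^*$ of the ODE $\dot{\mathbf m}=\tau(\phi(\mathbf m)-\mathbf m)$ is a uniform global attractor; $\mathbf m^*$ non-singular), let $\mathbf M^{(N)}(0)$ be distributed according to a stationary distribution of the continuous-time configuration Markov chain of the $N$-bandit asynchronous system under WIP ($\alpha N\in\mathbb N$). Then there exist constants $b,c>0$, independent of $N$, such that $\|\mathbb E[\mathbf M^{(N)}(0)]-\mathbf m^*\|\le b\,e^{-cN}$.
   Context: Asynchronous restless bandit model: $\mathbf Q^0,\mathbf Q^1$ are $d\times d$ generator matrices ($Q^a_{ij}\ge0$ for $i\neq j$, rows summing to $0$), $\alpha\in(0,1)$; $N$ bandits evolve in continuous time, independently given actions, bandit $n$ jumping from $i$ to $j\ne i$ at rate $Q^{a_n(t)}_{ij}$. Strict indexability (Whittle indices defined via the single-bandit subsidy-$\nu$ problem with extra passive reward $\nu$ per unit time; nested passive sets; distinct indices) with states labeled $\nu_1>\dots>\nu_d$; unichain: every policy gives a single recurrent class. WIP keeps active at all times the $\alpha N$ bandits with highest indices. $\mathbf M^{(N)}(t)\in\Delta^d=\{\mathbf m\in[0,1]^d:\sum m_i=1\}$ is the vector of fractions of bandits in each state. $\tau:=\max_i\max_a|Q^a_{ii}|$, $P^a_{ij}:=Q^a_{ij}/\tau$ for $i\ne j$, $P^a_{ii}:=1-\sum_{k\ne i}P^a_{ik}$. $s(\mathbf m)$ is the unique $s$ with $\sum_{i<s}m_i\le\alpha<\sum_{i\le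 s}m_i$; $\phi_j(\mathbf m)=\sum_{i=1}^{s(\mathbf m)-1} m_i P^1_{ij} + (\alpha-\sum_{i=1}^{s(\mathbf m)-1}m_i)P^1_{s(\mathbf m)j} + (\sum_{i=1}^{s(\mathbf m)}m_i - \alpha)P^0_{s(\mathbf m)j} + \sum_{i=s(\mathbf m)+1}^{d} m_i P^0_{ij}$, with unique fixed point $\mathbf m^*$ (which is the unique equilibrium of the ODE). Uniform global attractor: for every $\epsilon>0$ there is $T(\epsilon)$ such that the ODE solution $\Phi_t\mathbf m$ from any $\mathbf m\in\Delta^d$ satisfies $\|\Phi_t\mathbf m-\mathbf m^*\|\le\epsilon$ for $t\ge T(\epsilon)$. Singular: $\sum_{j\le i}m_j=\alpha$ for some $i$. $\|\cdot\|$ sup norm. *)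

theory Defs
  imports "HOL-Analysis.Analysis"
begin

text \<open>States are 0,...,d-1 (0-based; paper's state k is our state k-1).
  Matrices are functions nat => nat => real, only entries with indices < d matter.\<close>

definition is_generator :: "nat \<Rightarrow> (nat \<Rightarrow> nat \<Rightarrow> real) \<Rightarrow> bool" where
  "is_generator d Q \<longleftrightarrow> (\<forall>i<d. \<forall>j<d. i \<noteq> j \<longrightarrow> 0 \<le> Q i j) \<and> (\<forall>i<d. (\<Sum>j<d. Q i j) = 0)"

definition policy_gen :: "(nat \<Rightarrow> nat \<Rightarrow> real) \<Rightarrow> (nat \<Rightarrow> nat \<Rightarrow> real) \<Rightarrow> (nat \<Rightarrow> bool)
    \<Rightarrow> nat \<Rightarrow> nat \<Rightarrow> real" where
  "policy_gen Q0 Q1 \<pi> i j = (if \<pi> i then Q1 i j else Q0 i j)"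

definition reach :: "nat \<Rightarrow> (nat \<Rightarrow> nat \<Rightarrow> real) \<Rightarrow> (nat \<times> nat) set" where
  "reach d G = {(i, j). i < d \<and> j < d \<and> i \<noteq> j \<and> 0 < G i j}\<^sup>*"

definition recurrent :: "nat \<Rightarrow> (nat \<Rightarrow> nat \<Rightarrow> real) \<Rightarrow> nat \<Rightarrow> bool" where
  "recurrent d G i \<longleftrightarrow> i < d \<and> (\<forall>j. (i, j) \<in> reach d G \<longrightarrow> (j, i) \<in> reach d G)"

definition unichain :: "nat \<Rightarrow> (nat \<Rightarrow> nat \<Rightarrow> real) \<Rightarrow> (nat \<Rightarrow> nat \<Rightarrow> real) \<Rightarrow> bool" where
  "unichain d Q0 Q1 \<longleftrightarrow> (\<forall>\<pi> i j. recurrent d (policy_gen Q0 Q1 \<pi>) i \<and> recurrent d (policy_gen Q0 Q1 \<pi>) j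
      \<longrightarrow> (i, j) \<in> reach d (policy_gen Q0 Q1 \<pi>))"

text \<open>Average-reward optimality (Bellman) equation of the subsidy-nu problem:
  reward rate R1 i when active, R0 i + nu when passive.\<close>
definition bellman :: "nat \<Rightarrow> (nat \<Rightarrow> nat \<Rightarrow> real) \<Rightarrow> (nat \<Rightarrow> nat \<Rightarrow> real) \<Rightarrow> (nat \<Rightarrow> real) \<Rightarrow> (nat \<Rightarrow> real)
    \<Rightarrow> real \<Rightarrow> real \<Rightarrow> (nat \<Rightarrow> real) \<Rightarrow> bool" where
  "bellman d Q0 Q1 R0 R1 \<nu> g h \<longleftrightarrow>
     (\<forall>i<d. g = max (R0 i + \<nu> + (\<Sum>j<d. Q0 i j * h j)) (R1 i + (\<Sum>j<d. Q1 i j * h j)))"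

definition passive_set :: "nat \<Rightarrow> (nat \<Rightarrow> nat \<Rightarrow> real) \<Rightarrow> (nat \<Rightarrow> nat \<Rightarrow> real) \<Rightarrow> (nat \<Rightarrow> real) \<Rightarrow> (nat \<Rightarrow> real)
    \<Rightarrow> real \<Rightarrow> nat set" where
  "passive_set d Q0 Q1 R0 R1 \<nu> = {i. i < d \<and> (\<exists>g h. bellman d Q0 Q1 R0 R1 \<nu> g h \<and>
       R1 i + (\<Sum>j<d. Q1 i j * h j) \<le> R0 i + \<nu> + (\<Sum>j<d. Q0 i j * h j))}"

definition whittle_index :: "nat \<Rightarrow> (nat \<Rightarrow> nat \<Rightarrow> real) \<Rightarrow> (nat \<Rightarrow> nat \<Rightarrow> real) \<Rightarrow> (nat \<Rightarrow> real) \<Rightarrow> (nat \<Rightarrow> real)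
    \<Rightarrow> nat \<Rightarrow> real" where
  "whittle_index d Q0 Q1 R0 R1 i = Inf {\<nu>. i \<in> passive_set d Q0 Q1 R0 R1 \<nu>}"

definition strictly_indexable :: "nat \<Rightarrow> (nat \<Rightarrow> nat \<Rightarrow> real) \<Rightarrow> (nat \<Rightarrow> nat \<Rightarrow> real) \<Rightarrow> (nat \<Rightarrow> real)
    \<Rightarrow> (nat \<Rightarrow> real) \<Rightarrow> bool" where
  "strictly_indexable d Q0 Q1 R0 R1 \<longleftrightarrow>
     (\<forall>\<nu> \<nu>'. \<nu> \<le> \<nu>' \<longrightarrow> passive_set d Q0 Q1 R0 R1 \<nu> \<subseteq> passive_set d Q0 Q1 R0 R1 \<nu>') \<and>
     (\<forall>i<d. {\<nu>. i \<in> passive_set d Q0 Q1 R0 R1 \<nu>} \<noteq> {} \<and> bdd_below {\<nu>. i \<in> passive_set d Q0 Q1 R0 R1 \<nu>}) \<and>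
     inj_on (whittle_index d Q0 Q1 R0 R1) {..<d}"

definition tau :: "nat \<Rightarrow> (nat \<Rightarrow> nat \<Rightarrow> real) \<Rightarrow> (nat \<Rightarrow> nat \<Rightarrow> real) \<Rightarrow> real" where
  "tau d Q0 Q1 = Max ((\<lambda>i. max \<bar>Q0 i i\<bar> \<bar>Q1 i i\<bar>) ` {..<d})"

definition Pmat :: "nat \<Rightarrow> real \<Rightarrow> (nat \<Rightarrow> nat \<Rightarrow> real) \<Rightarrow> nat \<Rightarrow> nat \<Rightarrow> real" where
  "Pmat d t Q i j = (if i = j then 1 - (\<Sum>k\<in>{..<d} - {i}. Q i k / t) else Q i j / t)"

definition bsimplex :: "nat \<Rightarrow> (nat \<Rightarrow> real) set" where
  "bsimplex d = {m. (\<forall>i<d. 0 \<le> m i) \<and> (\<Sum>i<d. m i) = 1}"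

definition sidx :: "nat \<Rightarrow> real \<Rightarrow> (nat \<Rightarrow> real) \<Rightarrow> nat" where
  "sidx d \<alpha> m = (THE s. s < d \<and> (\<Sum>i<s. m i) \<le> \<alpha> \<and> \<alpha> < (\<Sum>i\<le>s. m i))"

definition phi :: "nat \<Rightarrow> (nat \<Rightarrow> nat \<Rightarrow> real) \<Rightarrow> (nat \<Rightarrow> nat \<Rightarrow> real) \<Rightarrow> real
    \<Rightarrow> (nat \<Rightarrow> real) \<Rightarrow> nat \<Rightarrow> real" where
  "phi d Q0 Q1 \<alpha> m j =
    (let t = tau d Q0 Q1; P0 = Pmat d t Q0; P1 = Pmat d t Q1; s = sidx d \<alpha> m in
       (\<Sum>i<s. m i * P1 i j) + (\<alpha> - (\<Sum>i<s. m i)) * P1 s j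
       + ((\<Sum>i\<le>s. m i) - \<alpha>) * P0 s j + (\<Sum>i\<in>{s<..<d}. m i * P0 i j))"

definition ode_solution :: "nat \<Rightarrow> (nat \<Rightarrow> nat \<Rightarrow> real) \<Rightarrow> (nat \<Rightarrow> nat \<Rightarrow> real) \<Rightarrow> real
    \<Rightarrow> (real \<Rightarrow> nat \<Rightarrow> real) \<Rightarrow> bool" where
  "ode_solution d Q0 Q1 \<alpha> x \<longleftrightarrow> (\<forall>t\<ge>0. x t \<in> bsimplex d) \<and>
     (\<forall>t\<ge>0. \<forall>i<d. ((\<lambda>u. x u i) has_real_derivative
         tau d Q0 Q1 * (phi d Q0 Q1 \<alpha> (x t) i - x t i)) (at t within {0..}))"

definition uniform_global_attractor :: "nat \<Rightarrow> (nat \<Rightarrow> nat \<Rightarrow> real) \<Rightarrow> (nat \<Rightarrow> nat \<Rightarrow> real) \<Rightarrow> real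
    \<Rightarrow> (nat \<Rightarrow> real) \<Rightarrow> bool" where
  "uniform_global_attractor d Q0 Q1 \<alpha> ms \<longleftrightarrow>
     (\<forall>\<epsilon>>0. \<exists>T. \<forall>x. ode_solution d Q0 Q1 \<alpha> x \<longrightarrow> (\<forall>t\<ge>T. \<forall>i<d. \<bar>x t i - ms i\<bar> \<le> \<epsilon>))"

definition singular :: "nat \<Rightarrow> real \<Rightarrow> (nat \<Rightarrow> real) \<Rightarrow> bool" where
  "singular d \<alpha> m \<longleftrightarrow> (\<exists>i<d. (\<Sum>j\<le>i. m j) = \<alpha>)"

definition configs :: "nat \<Rightarrow> nat \<Rightarrow> (nat \<Rightarrow> nat) set" where
  "configs d N = {x. (\<forall>i\<ge>d. x i = 0) \<and> (\<Sum>i<d. x i) = N}"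

text \<open>Number of active bandits in state i under WIP with K = alpha N active bandits
  (states with smaller label have higher Whittle index).\<close>
definition wip_active :: "nat \<Rightarrow> (nat \<Rightarrow> nat) \<Rightarrow> nat \<Rightarrow> nat" where
  "wip_active K x i = min (x i) (K - (\<Sum>k<i. x k))"

definition move :: "(nat \<Rightarrow> nat) \<Rightarrow> nat \<Rightarrow> nat \<Rightarrow> nat \<Rightarrow> nat" where
  "move x i j = x(i := x i - 1, j := x j + 1)"

definition wip_rate :: "nat \<Rightarrow> (nat \<Rightarrow> nat \<Rightarrow> real) \<Rightarrow> (nat \<Rightarrow> nat \<Rightarrow> real) \<Rightarrow> nat
    \<Rightarrow> (nat \<Rightarrow> nat) \<Rightarrow> (nat \<Rightarrow> nat) \<Rightarrow> real" where
  "wip_rate d Q0 Q1 K x y = (\<Sum>i<d. \<Sum>j\<in>{..<d} - {i}.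
      (if y = move x i j then real (wip_active K x i) * Q1 i j + real (x i - wip_active K x i) * Q0 i j
       else 0))"

definition wip_stationary :: "nat \<Rightarrow> (nat \<Rightarrow> nat \<Rightarrow> real) \<Rightarrow> (nat \<Rightarrow> nat \<Rightarrow> real) \<Rightarrow> nat \<Rightarrow> nat
    \<Rightarrow> ((nat \<Rightarrow> nat) \<Rightarrow> real) \<Rightarrow> bool" where
  "wip_stationary d Q0 Q1 N K p \<longleftrightarrow>
     (\<forall>x\<in>configs d N. 0 \<le> p x) \<and> (\<Sum>x\<in>configs d N. p x) = 1 \<and>
     (\<forall>y\<in>configs d N. (\<Sum>x\<in>configs d N - {y}. p x * wip_rate d Q0 Q1 K x y)
                        = p y * (\<Sum>z\<in>configs d N - {y}. wip_rate d Q0 Q1 K y z))"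

definition mean_M :: "nat \<Rightarrow> nat \<Rightarrow> ((nat \<Rightarrow> nat) \<Rightarrow> real) \<Rightarrow> nat \<Rightarrow> real" where
  "mean_M d N p i = (\<Sum>x\<in>configs d N. p x * (real (x i) / real N))"

end

(*
  On the simplex the mean drift of the fractions is a Lipschitz vector field G, affine near the
  non-singular mstar, and stationarity gives E[G(M)] = 0. Hence the theorem follows from two facts.

  Concentration: P(|M - mstar| > R) is exponentially small in N. For a small step h, the maximum
  over k of w^k (|x_k - mstar| - R/2)^+ along the Euler scheme x_k of the ODE is a Lipschitz
  function V that decreases geometrically at every Euler step. An inf-convolution W of V is
  semiconcave, so that exp(theta N W) is a Lyapunov function of the N-bandit chain, and its
  generator has stationary mean 0. Continuous-time trajectories of the chain are never needed.

  Invertibility: the linear part of G at mstar is bounded below on directions into the simplex.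
  A trajectory starting at distance sigma from mstar must come within sigma/2 of it in a time
  independent of the starting point, so it cannot start too slowly.

  The attractor hypothesis speaks about exact solutions; limits of dyadic Euler schemes provide
  them, and transfer the attraction to the Euler scheme uniformly in the starting point.
*)
theory Submission
  imports Defs
begin

section \<open>Euler schemes of Lipschitz vector fields\<close>

text \<open>Let A be the linear part of G at \<open>mstar\<close>. Since A(M - mstar) - G(M)
  vanishes on a ball and is bounded elsewhere, while E[G(M)] = 0, the vector A(E[M] - mstar) is
  bounded by a multiple of the probability of lying outside that ball. A curved G would leave a term
  of the size of the variance; exact affineness is what allows an exponential bound. The obstacle is
  concentration: V has kinks, so jumps of size 1/N cannot be expanded along it. If y nearly
  minimises V(y) + |m - y|^2 / (2 eps), then (m - y) / eps serves as a gradient of W at m, and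
  testing y against its own Euler step shows that this gradient pairs negatively with G where V is
  large, without any derivative of V. The errors are of order eps, h / eps, theta and 1/N, up to
  factors that depend on the earlier choices. So the constants are fixed in the order eps, h, theta,
  threshold for N, which needs a Lipschitz constant and a decrease rate of V independent of
  h.\<close>

definition l1_dist :: "nat \<Rightarrow> (nat \<Rightarrow> real) \<Rightarrow> (nat \<Rightarrow> real) \<Rightarrow> real" where
  "l1_dist d x y = (\<Sum>i<d. \<bar>x i - y i\<bar>)"

lemma l1_dist_nonneg [simp]: "0 \<le> l1_dist d x y"
  by (simp add: l1_dist_def sum_nonneg)

lemma l1_dist_self [simp]: "l1_dist d x x = 0"
  by (simp add: l1_dist_def)

lemma l1_dist_commute: "l1_dist d x y = l1_dist d y x"
  by (simp add: l1_dist_def abs_minus_commute)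

lemma l1_dist_triangle: "l1_dist d x z \<le> l1_dist d x y + l1_dist d y z"
  unfolding l1_dist_def sum.distrib[symmetric] by (intro sum_mono) auto

lemma abs_diff_le_l1_dist: "i < d \<Longrightarrow> \<bar>x i - y i\<bar> \<le> l1_dist d x y"
  unfolding l1_dist_def by (rule member_le_sum) auto

lemma l1_dist_coord_le:
  assumes "\<And>i. i < d \<Longrightarrow> \<bar>x i - y i\<bar> \<le> c"
  shows "l1_dist d x y \<le> real d * c"
  using sum_mono[of "{..<d}" "\<lambda>i. \<bar>x i - y i\<bar>" "\<lambda>_. c"] assms
  by (simp add: l1_dist_def)

text \<open>The tail of the geometric series from \<open>k\<close> on is
  \<open>2 * C * (1/2) ^ k\<close>. The rate is explicit because Euler schemes must approach the
  flow uniformly in the starting point. Steps are controlled only from \<open>k0\<close> on, since a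
  coarse mesh may leave the domain.\<close>

lemma geometric_steps_limit:
  fixes X :: "nat \<Rightarrow> real"
  assumes "\<And>k. k \<ge> k0 \<Longrightarrow> \<bar>X (Suc k) - X k\<bar> \<le> C * (1/2) ^ k"
  shows "X \<longlonglongrightarrow> lim X" and "k \<ge> k0 \<Longrightarrow> \<bar>X k - lim X\<bar> \<le> 2 * C * (1/2) ^ k"
proof -
  have C: "C \<ge> 0"
  proof -
    have "0 \<le> C * (1/2) ^ k0" using assms[of k0] by linarith
    then show ?thesis using zero_less_power[of "1/2::real" k0] by (simp only: zero_le_mult_iff) linarith
  qed
  \<comment> \<open>Keeping the remaining tail lets the induction close: one more step costs
    \<open>C * (1/2) ^ (k + n)\<close>, exactly the decrease of that tail.\<close>
  have tele: "\<bar>X (k + n) - X k\<bar> \<le> 2 * C * ((1/2) ^ k - (1/2) ^ (k + n))" if "k \<ge> k0" for k n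
  proof (induction n)
    case (Suc n)
    have "\<bar>X (Suc (k + n)) - X (k + n)\<bar> \<le> C * (1/2) ^ (k + n)"
      using that by (intro assms) auto
    with Suc show ?case by (simp add: algebra_simps)
  qed simp
  have near: "\<bar>X (k + n) - X k\<bar> \<le> 2 * C * (1/2) ^ k" if "k \<ge> k0" for k n
  proof -
    have "2 * C * ((1/2) ^ k - (1/2) ^ (k + n)) \<le> 2 * C * (1/2) ^ k"
      using C by (intro mult_left_mono) auto
    with tele[OF that, of n] show ?thesis by linarith
  qed
  have z: "(\<lambda>k. 2 * C * (1/2::real) ^ k) \<longlonglongrightarrow> 0"
    by (intro tendsto_mult_right_zero LIMSEQ_power_zero) auto
  have "Cauchy X"
  proof (rule metric_CauchyI)
    fix e :: real assume e: "e > 0"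
    then obtain K where K: "\<And>k. k \<ge> K \<Longrightarrow> 2 * C * (1/2::real) ^ k < e / 2"
      using order_tendstoD(2)[OF z, of "e/2"] by (auto simp: eventually_sequentially)
    define M where "M = max K k0"
    have *: "\<bar>X m - X M\<bar> < e / 2" if "m \<ge> M" for m
      using near[of M "m - M"] K[of M] that by (auto simp: M_def)
    show "\<exists>M. \<forall>m\<ge>M. \<forall>n\<ge>M. dist (X m) (X n) < e"
    proof (intro exI allI impI)
      fix m n assume "m \<ge> M" "n \<ge> M"
      then show "dist (X m) (X n) < e"
        using *[of m] *[of n] unfolding dist_real_def by linarith
    qed
  qed
  then show lim: "X \<longlonglongrightarrow> lim X"
    by (simp add: Cauchy_convergent_iff convergent_LIMSEQ_iff)
  assume k: "k \<ge> k0"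
  have "(\<lambda>n. \<bar>X k - X (n + k)\<bar>) \<longlonglongrightarrow> \<bar>X k - lim X\<bar>"
    by (intro tendsto_intros LIMSEQ_ignore_initial_segment lim)
  then show "\<bar>X k - lim X\<bar> \<le> 2 * C * (1/2) ^ k"
    by (rule Lim_bounded) (use near[OF k] in \<open>auto simp: add.commute abs_minus_commute\<close>)
qed

section \<open>Stability and accuracy of the Euler scheme\<close>

definition euler_step :: "((nat \<Rightarrow> real) \<Rightarrow> nat \<Rightarrow> real) \<Rightarrow> real \<Rightarrow> (nat \<Rightarrow> real) \<Rightarrow> nat \<Rightarrow> real" where
  "euler_step F h x = (\<lambda>i. x i + h * F x i)"

text \<open>Points are functions on all naturals of which only the coordinates below
  \<open>d\<close> count, so \<open>l1_dist\<close> is a pseudometric and closedness of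
  \<open>X\<close> is stated coordinatewise. Invariance under small Euler steps keeps the scheme,
  and hence its limit, where the field is controlled.\<close>

locale lipschitz_field =
  fixes d :: nat and F :: "(nat \<Rightarrow> real) \<Rightarrow> nat \<Rightarrow> real" and X :: "(nat \<Rightarrow> real) set"
    and L B h0 :: real
  assumes L_nonneg: "0 \<le> L" and B_nonneg: "0 \<le> B" and h0_pos: "0 < h0"
    and lip: "\<And>x y. x \<in> X \<Longrightarrow> y \<in> X \<Longrightarrow> l1_dist d (F x) (F y) \<le> L * l1_dist d x y"
    and bounded: "\<And>x. x \<in> X \<Longrightarrow> l1_dist d (F x) (\<lambda>_. 0) \<le> B"
    and step_in: "\<And>x h. x \<in> X \<Longrightarrow> 0 \<le> h \<Longrightarrow> h \<le> h0 \<Longrightarrow> euler_step F h x \<in> X"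
    and closed_coord: "\<And>u v. (\<And>k. u k \<in> X) \<Longrightarrow> (\<And>i. i < d \<Longrightarrow> (\<lambda>k. u k i) \<longlonglongrightarrow> v i) \<Longrightarrow> v \<in> X"
begin

abbreviation iter :: "real \<Rightarrow> nat \<Rightarrow> (nat \<Rightarrow> real) \<Rightarrow> nat \<Rightarrow> real" where
  "iter h n \<equiv> (euler_step F h ^^ n)"

lemma iter_in:
  assumes "x \<in> X" "0 \<le> h" "h \<le> h0"
  shows "iter h n x \<in> X"
  using assms by (induction n) (auto intro: step_in)

lemma step_lip:
  assumes "x \<in> X" "y \<in> X" "0 \<le> h"
  shows "l1_dist d (euler_step F h x) (euler_step F h y) \<le> (1 + L * h) * l1_dist d x y"
proof -
  have "l1_dist d (euler_step F h x) (euler_step F h y) \<le> (\<Sum>i<d. \<bar>x i - y i\<bar> + h * \<bar>F x i - F y i\<bar>)"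
    unfolding l1_dist_def euler_step_def
  proof (rule sum_mono)
    fix i
    have "x i + h * F x i - (y i + h * F y i) = (x i - y i) + h * (F x i - F y i)"
      by (simp add: algebra_simps)
    then show "\<bar>x i + h * F x i - (y i + h * F y i)\<bar> \<le> \<bar>x i - y i\<bar> + h * \<bar>F x i - F y i\<bar>"
      using assms(3) by (metis abs_mult abs_of_nonneg abs_triangle_ineq)
  qed
  also have "\<dots> = l1_dist d x y + h * l1_dist d (F x) (F y)"
    by (simp add: l1_dist_def sum.distrib sum_distrib_left)
  also have "\<dots> \<le> l1_dist d x y + h * (L * l1_dist d x y)"
    using lip[OF assms(1,2)] assms(3) by (intro add_left_mono mult_left_mono)
  finally show ?thesis by (simp add: algebra_simps)
qed

text \<open>Since \<open>1 + L * h <= exp (L * h)\<close>, growth is bounded through the elapsed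
  time \<open>n * h\<close> alone, whatever the mesh.\<close>

lemma growth_le_exp: "0 \<le> h \<Longrightarrow> (1 + L * h) ^ n \<le> exp (L * (real n * h))"
proof -
  assume "0 \<le> h"
  then have "(1 + L * h) ^ n \<le> exp (L * h) ^ n"
    using L_nonneg by (intro power_mono) (auto simp: add.commute exp_ge_add_one_self_aux)
  also have "\<dots> = exp (L * (real n * h))"
    by (simp add: exp_of_nat_mult[symmetric] algebra_simps)
  finally show ?thesis .
qed

lemma iter_lip_power:
  assumes "x \<in> X" "y \<in> X" "0 \<le> h" "h \<le> h0"
  shows "l1_dist d (iter h n x) (iter h n y) \<le> (1 + L * h) ^ n * l1_dist d x y"
proof (induction n)
  case (Suc n)
  have "l1_dist d (iter h (Suc n) x) (iter h (Suc n) y) \<le> (1 + L * h) * l1_dist d (iter h n x) (iter h n y)"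
    using step_lip[OF iter_in iter_in] assms by simp
  also have "\<dots> \<le> (1 + L * h) * ((1 + L * h) ^ n * l1_dist d x y)"
    using Suc L_nonneg assms by (intro mult_left_mono) auto
  finally show ?case by (simp add: mult.assoc)
qed simp

lemma iter_lip:
  assumes "x \<in> X" "y \<in> X" "0 \<le> h" "h \<le> h0"
  shows "l1_dist d (iter h n x) (iter h n y) \<le> exp (L * (real n * h)) * l1_dist d x y"
  using iter_lip_power[OF assms, of n] growth_le_exp[OF assms(3), of n]
  by (meson l1_dist_nonneg mult_right_mono order_trans)

lemma l1_dist_step:
  assumes "0 \<le> h"
  shows "l1_dist d (euler_step F h x) x = h * l1_dist d (F x) (\<lambda>_. 0)"
  using assms by (simp add: l1_dist_def euler_step_def abs_mult sum_distrib_left)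

text \<open>The displacement in step \<open>m\<close> is the first displacement transported by
  \<open>m\<close> iterations. Unlike \<open>iter_speed\<close>, this gives a bound proportional to
  the initial speed: a start nearly at rest stays near for a bounded time.\<close>

lemma iter_move:
  assumes "x \<in> X" "0 \<le> h" "h \<le> h0"
  shows "l1_dist d (iter h n x) x \<le> real n * h * exp (L * (real n * h)) * l1_dist d (F x) (\<lambda>_. 0)"
proof -
  let ?c = "h * l1_dist d (F x) (\<lambda>_. 0)"
  have c: "0 \<le> ?c" using assms by simp
  \<comment> \<open>The growth factor is frozen at its final power \<open>n\<close>, so that all
    summands get the same bound.\<close>
  have "l1_dist d (iter h m x) x \<le> real m * ((1 + L * h) ^ n * ?c)" if "m \<le> n" for m
    using that
  proof (induction m)
    case (Suc m)
    have "l1_dist d (iter h m (euler_step F h x)) (iter h m x) \<le> (1 + L * h) ^ m * l1_dist d (euler_step F h x) x"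
      using assms by (intro iter_lip_power step_in)
    also have "\<dots> = (1 + L * h) ^ m * ?c" using assms by (simp add: l1_dist_step)
    also have "\<dots> \<le> (1 + L * h) ^ n * ?c"
      using Suc.prems L_nonneg assms c by (intro mult_right_mono power_increasing) auto
    finally have "l1_dist d (iter h (Suc m) x) (iter h m x) \<le> (1 + L * h) ^ n * ?c"
      by (simp add: funpow_swap1)
    moreover have "l1_dist d (iter h m x) x \<le> real m * ((1 + L * h) ^ n * ?c)"
      using Suc by simp
    ultimately show ?case
      using l1_dist_triangle[of d "iter h (Suc m) x" x "iter h m x"] by (simp add: algebra_simps)
  qed simp
  then have "l1_dist d (iter h n x) x \<le> real n * ((1 + L * h) ^ n * ?c)" by blast
  also have "\<dots> \<le> real n * (exp (L * (real n * h)) * ?c)"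
    using growth_le_exp[OF assms(2), of n] c by (intro mult_left_mono mult_right_mono) auto
  finally show ?thesis by (simp add: algebra_simps)
qed

lemma iter_speed:
  assumes "x \<in> X" "0 \<le> h" "h \<le> h0"
  shows "l1_dist d (iter h n x) x \<le> real n * h * B"
proof (induction n)
  case (Suc n)
  have "l1_dist d (iter h (Suc n) x) (iter h n x) \<le> h * B"
    using l1_dist_step[OF assms(2), of "iter h n x"] bounded[OF iter_in[OF assms]] assms(2)
    by (simp add: mult_left_mono)
  with Suc show ?case
    using l1_dist_triangle[of d "iter h (Suc n) x" x "iter h n x"] by (simp add: algebra_simps)
qed simp

text \<open>After \<open>n\<close> steps the scheme is within \<open>n * h * B\<close> of
  \<open>x\<close>, so the field is off by at most \<open>L * n * h * B\<close>. Summed, these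
  errors are quadratic in the elapsed time with a constant free of the mesh, and therefore survive
  the limit.\<close>

lemma iter_second_order:
  assumes "x \<in> X" "0 \<le> h" "h \<le> h0"
  shows "l1_dist d (iter h n x) (\<lambda>i. x i + real n * h * F x i) \<le> L * B * (real n * h)\<^sup>2"
proof (induction n)
  case (Suc n)
  let ?y = "iter h n x"
  have "l1_dist d (iter h (Suc n) x) (\<lambda>i. x i + real (Suc n) * h * F x i)
      \<le> (\<Sum>i<d. \<bar>?y i - (x i + real n * h * F x i)\<bar> + h * \<bar>F ?y i - F x i\<bar>)"
    unfolding l1_dist_def
  proof (rule sum_mono)
    fix i
    have "iter h (Suc n) x i - (x i + real (Suc n) * h * F x i)
        = (?y i - (x i + real n * h * F x i)) + h * (F ?y i - F x i)"
      by (simp add: euler_step_def algebra_simps)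
    then show "\<bar>iter h (Suc n) x i - (x i + real (Suc n) * h * F x i)\<bar>
        \<le> \<bar>?y i - (x i + real n * h * F x i)\<bar> + h * \<bar>F ?y i - F x i\<bar>"
      using assms(2) by (metis abs_mult abs_of_nonneg abs_triangle_ineq)
  qed
  also have "\<dots> = l1_dist d ?y (\<lambda>i. x i + real n * h * F x i) + h * l1_dist d (F ?y) (F x)"
    by (simp add: l1_dist_def sum.distrib sum_distrib_left)
  also have "\<dots> \<le> L * B * (real n * h)\<^sup>2 + h * (L * (real n * h * B))"
  proof -
    have "l1_dist d (F ?y) (F x) \<le> L * l1_dist d ?y x"
      using assms by (intro lip iter_in)
    also have "\<dots> \<le> L * (real n * h * B)"
      using iter_speed[OF assms] L_nonneg by (intro mult_left_mono)
    finally show ?thesis using Suc assms(2) by (intro add_mono mult_left_mono)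
  qed
  also have "\<dots> = L * B * h\<^sup>2 * ((real n)\<^sup>2 + real n)"
    by (simp add: power2_eq_square algebra_simps)
  also have "\<dots> \<le> L * B * h\<^sup>2 * (real (Suc n))\<^sup>2"
    using L_nonneg B_nonneg by (intro mult_left_mono) (auto simp: power2_eq_square algebra_simps)
  finally show ?case by (simp only: power_mult_distrib mult_ac)
qed simp

text \<open>Two half steps differ from a full step by at most \<open>L * B * h^2\<close>, by
  \<open>iter_second_order\<close>. Stability amplifies each local error by at most
  \<open>(1 + L * h) ^ n\<close>, so the total is of first order in \<open>h\<close>.\<close>

lemma iter_refine:
  assumes "x \<in> X" "0 \<le> h" "h \<le> h0"
  shows "l1_dist d (iter h n x) (iter (h/2) (2 * n) x) \<le> real n * h * exp (L * (real n * h)) * (L * B * h)"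
proof -
  have h2: "0 \<le> h/2" "h/2 \<le> h0" using assms by auto
  have LB: "0 \<le> L * B * h\<^sup>2" using L_nonneg B_nonneg by simp
  have g: "1 \<le> 1 + L * h" using L_nonneg assms by simp
  have "l1_dist d (iter h n x) (iter (h/2) (2 * n) x) \<le> real n * ((1 + L * h) ^ n * (L * B * h\<^sup>2))"
  proof (induction n)
    case (Suc n)
    let ?y = "iter h n x" and ?z = "iter (h/2) (2 * n) x"
    have z: "?z \<in> X" and y: "?y \<in> X" using assms h2 iter_in by blast+
    have eq: "iter (h/2) (2 * Suc n) x = iter (h/2) 2 ?z"
      by (simp add: numeral_2_eq_2)
    have "l1_dist d (euler_step F h ?z) (iter (h/2) 2 ?z) \<le> L * B * h\<^sup>2"
      using iter_second_order[OF z h2, of 2]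
      by (simp add: l1_dist_commute[of d "iter (h/2) 2 ?z"] euler_step_def)
    moreover have "l1_dist d (euler_step F h ?y) (euler_step F h ?z)
        \<le> (1 + L * h) * (real n * ((1 + L * h) ^ n * (L * B * h\<^sup>2)))"
      using step_lip[OF y z assms(2)] Suc g
      by (meson mult_left_mono order_trans zero_le_one)
    moreover have "L * B * h\<^sup>2 \<le> (1 + L * h) ^ Suc n * (L * B * h\<^sup>2)"
      using LB one_le_power[OF g, of "Suc n"] mult_right_mono[of 1 "(1 + L * h) ^ Suc n" "L * B * h\<^sup>2"] by simp
    ultimately show ?case
      using l1_dist_triangle[of d "iter h (Suc n) x" "iter (h/2) (2 * Suc n) x" "euler_step F h ?z"]
      unfolding eq by (simp add: algebra_simps)
  qed simp
  also have "\<dots> \<le> real n * (exp (L * (real n * h)) * (L * B * h\<^sup>2))"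
    using growth_le_exp[OF assms(2), of n] LB by (intro mult_left_mono mult_right_mono) auto
  finally show ?thesis by (simp add: algebra_simps power2_eq_square)
qed

section \<open>The exact flow as a limit of Euler schemes on dyadic grids\<close>

definition dyadic :: "(nat \<Rightarrow> real) \<Rightarrow> nat \<Rightarrow> real \<Rightarrow> nat \<Rightarrow> real" where
  "dyadic x k t = iter ((1/2) ^ k) (nat \<lfloor>2 ^ k * t\<rfloor>) x"

definition flow :: "(nat \<Rightarrow> real) \<Rightarrow> real \<Rightarrow> nat \<Rightarrow> real" where
  "flow x t i = lim (\<lambda>k. dyadic x k t i)"

lemma mesh_small: "\<exists>n. \<forall>k\<ge>n. (1/2::real) ^ k \<le> c" if "0 < c" for c
proof -
  have "(\<lambda>k. (1/2::real) ^ k) \<longlonglongrightarrow> 0" by (rule LIMSEQ_power_zero) auto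
  from order_tendstoD(2)[OF this that] show ?thesis
    by (auto simp: eventually_sequentially intro: less_imp_le)
qed

definition min_level :: nat where "min_level = (SOME n. \<forall>k\<ge>n. (1/2::real) ^ k \<le> h0)"

lemma mesh_le_h0: "k \<ge> min_level \<Longrightarrow> (1/2::real) ^ k \<le> h0"
  using someI_ex[OF mesh_small[OF h0_pos]] unfolding min_level_def by blast

lemma dyadic_in: "x \<in> X \<Longrightarrow> k \<ge> min_level \<Longrightarrow> dyadic x k t \<in> X"
  unfolding dyadic_def by (intro iter_in mesh_le_h0) auto

text \<open>The first term is the cost of halving the mesh over time \<open>t\<close>; the second
  pays for the half step by which the rounded end times on successive grids can differ.\<close>

definition flow_const :: "real \<Rightarrow> real" where
  "flow_const t = t * exp (L * t) * (L * B) + B"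

lemma flow_const_nonneg: "0 \<le> t \<Longrightarrow> 0 \<le> flow_const t"
  using L_nonneg B_nonneg by (simp add: flow_const_def)

lemma dyadic_step:
  assumes x: "x \<in> X" and t: "0 \<le> t" and k: "k \<ge> min_level"
  shows "l1_dist d (dyadic x (Suc k) t) (dyadic x k t) \<le> flow_const t * (1/2) ^ k"
proof -
  define h :: real where "h = (1/2) ^ k"
  define n where "n = nat \<lfloor>2 ^ k * t\<rfloor>"
  define m where "m = nat \<lfloor>2 ^ Suc k * t\<rfloor>"
  have h: "0 \<le> h" "h \<le> h0" "0 \<le> h/2" "h/2 \<le> h0" using mesh_le_h0[OF k] h0_pos by (auto simp: h_def)
  have n: "real n \<le> 2 ^ k * t" "2 ^ k * t < real n + 1"
    using t by (auto simp: n_def)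
  have m: "real m \<le> 2 ^ Suc k * t" "2 ^ Suc k * t < real m + 1"
    using t unfolding m_def by (auto simp del: power_Suc)
  have hk: "h * 2 ^ k = 1" by (simp add: h_def power_one_over)
  have nh: "real n * h \<le> t"
  proof -
    have "real n * h \<le> 2 ^ k * t * h" using n h by (intro mult_right_mono)
    also have "\<dots> = t" using hk by (simp add: mult_ac)
    finally show ?thesis .
  qed
  \<comment> \<open>Doubling before rounding down gives twice the rounded value or one more, so the
    finer grid takes at most one extra half step.\<close>
  obtain r where r: "m = r + 2 * n" "r \<le> 1"
  proof
    have "real (2 * n) < real (m + 1)" "real m < real (2 * n + 2)" using n m by (auto simp: algebra_simps)
    then have "2 * n < m + 1" "m < 2 * n + 2" by linarith+
    then show "m = (m - 2 * n) + 2 * n" "m - 2 * n \<le> 1" by auto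
  qed
  let ?z = "iter (h/2) (2 * n) x"
  have z: "?z \<in> X" using x h by (intro iter_in)
  have 1: "l1_dist d (iter (h/2) m x) ?z \<le> h * B"
  proof -
    have "l1_dist d (iter (h/2) m x) ?z \<le> real r * (h/2) * B"
      using iter_speed[OF z h(3,4), of r] by (simp add: r funpow_add)
    also have "\<dots> \<le> 1 * h * B" using r h B_nonneg by (intro mult_mono) auto
    finally show ?thesis by simp
  qed
  have 2: "l1_dist d (iter h n x) ?z \<le> t * exp (L * t) * (L * B * h)"
  proof -
    have "real n * h * exp (L * (real n * h)) * (L * B * h) \<le> t * exp (L * t) * (L * B * h)"
      using nh h L_nonneg B_nonneg t by (intro mult_right_mono mult_mono) (auto intro!: mult_left_mono)
    then show ?thesis using iter_refine[OF x h(1,2), of n] by linarith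
  qed
  have "dyadic x (Suc k) t = iter (h/2) m x" "dyadic x k t = iter h n x"
    by (simp_all add: dyadic_def h_def n_def m_def)
  then show ?thesis
    using l1_dist_triangle[of d "iter (h/2) m x" "iter h n x" ?z] 1 2
    by (simp add: l1_dist_commute[of d _ "iter h n x"] flow_const_def h_def[symmetric] algebra_simps)
qed

lemma dyadic_tendsto:
  assumes x: "x \<in> X" and t: "0 \<le> t" and i: "i < d"
  shows "(\<lambda>k. dyadic x k t i) \<longlonglongrightarrow> flow x t i"
    and "k \<ge> min_level \<Longrightarrow> \<bar>dyadic x k t i - flow x t i\<bar> \<le> 2 * flow_const t * (1/2) ^ k"
proof -
  have "\<bar>dyadic x (Suc k) t i - dyadic x k t i\<bar> \<le> flow_const t * (1/2) ^ k" if "k \<ge> min_level" for k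
    using abs_diff_le_l1_dist[OF i, of "dyadic x (Suc k) t" "dyadic x k t"] dyadic_step[OF x t that]
    by linarith
  from geometric_steps_limit[where X = "\<lambda>k. dyadic x k t i", OF this]
  show "(\<lambda>k. dyadic x k t i) \<longlonglongrightarrow> flow x t i"
    and "k \<ge> min_level \<Longrightarrow> \<bar>dyadic x k t i - flow x t i\<bar> \<le> 2 * flow_const t * (1/2) ^ k"
    unfolding flow_def by blast+
qed

lemma flow_in:
  assumes x: "x \<in> X" and t: "0 \<le> t"
  shows "flow x t \<in> X"
proof (rule closed_coord)
  show "dyadic x (k + min_level) t \<in> X" for k using x by (intro dyadic_in) auto
  show "(\<lambda>k. dyadic x (k + min_level) t i) \<longlonglongrightarrow> flow x t i" if "i < d" for i
    using dyadic_tendsto(1)[OF x t that] by (rule LIMSEQ_ignore_initial_segment)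
qed

lemma dyadic_field_tendsto:
  assumes x: "x \<in> X" and t: "0 \<le> t" and i: "i < d"
  shows "(\<lambda>k. F (dyadic x k t) i) \<longlonglongrightarrow> F (flow x t) i"
proof (rule LIM_zero_cancel, rule Lim_null_comparison)
  have "\<bar>F (dyadic x k t) i - F (flow x t) i\<bar> \<le> L * (\<Sum>j<d. \<bar>dyadic x k t j - flow x t j\<bar>)"
    if "k \<ge> min_level" for k
    using abs_diff_le_l1_dist[OF i, of "F (dyadic x k t)" "F (flow x t)"]
      lip[OF dyadic_in[OF x that] flow_in[OF x t], of t] by (simp add: l1_dist_def)
  then show "\<forall>\<^sub>F k in sequentially. norm (F (dyadic x k t) i - F (flow x t) i)
      \<le> L * (\<Sum>j<d. \<bar>dyadic x k t j - flow x t j\<bar>)"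
    unfolding real_norm_def eventually_sequentially by blast
  have "(\<lambda>k. L * (\<Sum>j<d. \<bar>dyadic x k t j - flow x t j\<bar>)) \<longlonglongrightarrow> L * (\<Sum>j<d. \<bar>flow x t j - flow x t j\<bar>)"
    using dyadic_tendsto(1)[OF x t] by (intro tendsto_intros) auto
  then show "(\<lambda>k. L * (\<Sum>j<d. \<bar>dyadic x k t j - flow x t j\<bar>)) \<longlonglongrightarrow> 0" by simp
qed

lemma dyadic_time_tendsto:
  assumes "0 \<le> t"
  shows "(\<lambda>k. real (nat \<lfloor>2 ^ k * t\<rfloor>) * (1/2) ^ k) \<longlonglongrightarrow> t"
proof (rule LIM_zero_cancel, rule Lim_null_comparison)
  have "\<bar>real (nat \<lfloor>2 ^ k * t\<rfloor>) * (1/2) ^ k - t\<bar> \<le> (1/2) ^ k" for k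
  proof -
    have "\<bar>real (nat \<lfloor>2 ^ k * t\<rfloor>) - 2 ^ k * t\<bar> \<le> 1" using assms by (simp add: abs_if) linarith
    then have "\<bar>real (nat \<lfloor>2 ^ k * t\<rfloor>) - 2 ^ k * t\<bar> * (1/2) ^ k \<le> 1 * (1/2) ^ k"
      by (intro mult_right_mono) auto
    moreover have "(real (nat \<lfloor>2 ^ k * t\<rfloor>) - 2 ^ k * t) * (1/2) ^ k = real (nat \<lfloor>2 ^ k * t\<rfloor>) * (1/2) ^ k - t"
      by (simp add: algebra_simps power_one_over)
    ultimately show ?thesis by (simp add: abs_mult flip: \<open>(real (nat \<lfloor>2 ^ k * t\<rfloor>) - 2 ^ k * t) * (1/2) ^ k = real (nat \<lfloor>2 ^ k * t\<rfloor>) * (1/2) ^ k - t\<close>)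
  qed
  then show "\<forall>\<^sub>F k in sequentially. norm (real (nat \<lfloor>2 ^ k * t\<rfloor>) * (1/2) ^ k - t) \<le> (1/2) ^ k"
    by simp
  show "(\<lambda>k. (1/2::real) ^ k) \<longlonglongrightarrow> 0" by (rule LIMSEQ_power_zero) auto
qed

text \<open>The semigroup property on a fixed grid. Estimates between two times are proved for the
  scheme restarted at \<open>dyadic x k s\<close> and then passed to the limit, which avoids a
  semigroup property of the flow itself.\<close>

lemma dyadic_split:
  assumes "0 \<le> s" "s \<le> t"
  shows "dyadic x k t = iter ((1/2) ^ k) (nat \<lfloor>2 ^ k * t\<rfloor> - nat \<lfloor>2 ^ k * s\<rfloor>) (dyadic x k s)"
proof -
  have "nat \<lfloor>2 ^ k * s\<rfloor> \<le> nat \<lfloor>2 ^ k * t\<rfloor>"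
    using assms by (intro nat_mono floor_mono mult_left_mono) auto
  then have "iter ((1/2) ^ k) (nat \<lfloor>2 ^ k * t\<rfloor>) = iter ((1/2) ^ k) ((nat \<lfloor>2 ^ k * t\<rfloor> - nat \<lfloor>2 ^ k * s\<rfloor>) + nat \<lfloor>2 ^ k * s\<rfloor>)"
    by simp
  then show ?thesis
    unfolding dyadic_def funpow_add by simp
qed

lemma dyadic_dt_tendsto:
  assumes "0 \<le> s" "s \<le> t"
  shows "(\<lambda>k. real (nat \<lfloor>2 ^ k * t\<rfloor> - nat \<lfloor>2 ^ k * s\<rfloor>) * (1/2) ^ k) \<longlonglongrightarrow> t - s"
proof -
  have "nat \<lfloor>2 ^ k * s\<rfloor> \<le> nat \<lfloor>2 ^ k * t\<rfloor>" for k
    using assms by (intro nat_mono floor_mono mult_left_mono) auto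
  then have "real (nat \<lfloor>2 ^ k * t\<rfloor> - nat \<lfloor>2 ^ k * s\<rfloor>) * (1/2) ^ k
      = real (nat \<lfloor>2 ^ k * t\<rfloor>) * (1/2) ^ k - real (nat \<lfloor>2 ^ k * s\<rfloor>) * (1/2) ^ k" for k
    by (simp add: algebra_simps)
  then show ?thesis
    using tendsto_diff[OF dyadic_time_tendsto dyadic_time_tendsto, of t s] assms by simp
qed

lemma flow_speed:
  assumes x: "x \<in> X" and st: "0 \<le> s" "s \<le> t"
  shows "l1_dist d (flow x t) (flow x s) \<le> (t - s) * B"
proof (rule tendsto_le[OF sequentially_bot])
  show "(\<lambda>k. real (nat \<lfloor>2 ^ k * t\<rfloor> - nat \<lfloor>2 ^ k * s\<rfloor>) * (1/2) ^ k * B) \<longlonglongrightarrow> (t - s) * B"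
    by (intro tendsto_intros dyadic_dt_tendsto st)
  show "(\<lambda>k. l1_dist d (dyadic x k t) (dyadic x k s)) \<longlonglongrightarrow> l1_dist d (flow x t) (flow x s)"
    unfolding l1_dist_def using st by (intro tendsto_intros dyadic_tendsto(1) x) auto
  have "l1_dist d (dyadic x k t) (dyadic x k s)
      \<le> real (nat \<lfloor>2 ^ k * t\<rfloor> - nat \<lfloor>2 ^ k * s\<rfloor>) * (1/2) ^ k * B" if "k \<ge> min_level" for k
    unfolding dyadic_split[OF st] using that by (intro iter_speed dyadic_in x mesh_le_h0) auto
  then show "\<forall>\<^sub>F k in sequentially. l1_dist d (dyadic x k t) (dyadic x k s)
      \<le> real (nat \<lfloor>2 ^ k * t\<rfloor> - nat \<lfloor>2 ^ k * s\<rfloor>) * (1/2) ^ k * B"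
    unfolding eventually_sequentially by blast
qed

lemma flow_second_order:
  assumes x: "x \<in> X" and st: "0 \<le> s" "s \<le> t" and i: "i < d"
  shows "\<bar>flow x t i - (flow x s i + (t - s) * F (flow x s) i)\<bar> \<le> L * B * (t - s)\<^sup>2"
proof (rule tendsto_le[OF sequentially_bot])
  let ?n = "\<lambda>k. real (nat \<lfloor>2 ^ k * t\<rfloor> - nat \<lfloor>2 ^ k * s\<rfloor>) * (1/2) ^ k"
  show "(\<lambda>k. L * B * (?n k)\<^sup>2) \<longlonglongrightarrow> L * B * (t - s)\<^sup>2"
    by (intro tendsto_intros dyadic_dt_tendsto st)
  show "(\<lambda>k. \<bar>dyadic x k t i - (dyadic x k s i + ?n k * F (dyadic x k s) i)\<bar>)
      \<longlonglongrightarrow> \<bar>flow x t i - (flow x s i + (t - s) * F (flow x s) i)\<bar>"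
    using st i by (intro tendsto_intros dyadic_tendsto(1) dyadic_dt_tendsto dyadic_field_tendsto x) auto
  have "\<bar>dyadic x k t i - (dyadic x k s i + ?n k * F (dyadic x k s) i)\<bar> \<le> L * B * (?n k)\<^sup>2"
    if "k \<ge> min_level" for k
    using iter_second_order[OF dyadic_in[OF x that, of s] _ mesh_le_h0[OF that],
      of "nat \<lfloor>2 ^ k * t\<rfloor> - nat \<lfloor>2 ^ k * s\<rfloor>"] dyadic_split[OF st, of x k]
      abs_diff_le_l1_dist[OF i, of "dyadic x k t" "\<lambda>i. dyadic x k s i + ?n k * F (dyadic x k s) i"]
    by simp
  then show "\<forall>\<^sub>F k in sequentially. \<bar>dyadic x k t i - (dyadic x k s i + ?n k * F (dyadic x k s) i)\<bar>
      \<le> L * B * (?n k)\<^sup>2"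
    unfolding eventually_sequentially by blast
qed

lemma flow_has_derivative:
  assumes x: "x \<in> X" and t: "0 \<le> t" and i: "i < d"
  shows "((\<lambda>u. flow x u i) has_real_derivative F (flow x t) i) (at t within {0..})"
proof -
  have bd: "\<bar>flow x u i - flow x t i - (u - t) * F (flow x t) i\<bar> \<le> 2 * L * B * (u - t)\<^sup>2" if u: "0 \<le> u" for u
  proof (cases "t \<le> u")
    case True
    have "0 \<le> L * B * (u - t)\<^sup>2" using L_nonneg B_nonneg by simp
    then show ?thesis using flow_second_order[OF x t True i] by (simp add: algebra_simps)
  next
    \<comment> \<open>\<open>flow_second_order\<close> expands at the earlier time, here
      \<open>u\<close>. Replacing the field at \<open>u\<close> by the field at \<open>t\<close>
      costs another \<open>L * B * (u - t)^2\<close>, hence the factor 2.\<close>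
    case False
    then have ut: "u \<le> t" by simp
    have "\<bar>F (flow x u) i - F (flow x t) i\<bar> \<le> L * l1_dist d (flow x t) (flow x u)"
      using abs_diff_le_l1_dist[OF i] lip[OF flow_in[OF x u] flow_in[OF x t]]
      by (metis l1_dist_commute order_trans)
    also have "\<dots> \<le> L * ((t - u) * B)"
      using flow_speed[OF x u ut] L_nonneg by (intro mult_left_mono)
    finally have "(t - u) * \<bar>F (flow x u) i - F (flow x t) i\<bar> \<le> (t - u) * (L * ((t - u) * B))"
      using ut by (intro mult_left_mono) auto
    then have "\<bar>(t - u) * (F (flow x u) i - F (flow x t) i)\<bar> \<le> L * B * (u - t)\<^sup>2"
      using ut by (simp only: abs_mult power2_eq_square) (simp add: algebra_simps)
    moreover have "\<bar>flow x t i - (flow x u i + (t - u) * F (flow x u) i)\<bar> \<le> L * B * (u - t)\<^sup>2"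
      using flow_second_order[OF x u ut i] by (simp add: power2_commute)
    moreover have "flow x u i - flow x t i - (u - t) * F (flow x t) i =
       - (flow x t i - (flow x u i + (t - u) * F (flow x u) i)) - (t - u) * (F (flow x u) i - F (flow x t) i)"
      by (simp add: algebra_simps)
    ultimately show ?thesis by linarith
  qed
  show ?thesis
    unfolding has_field_derivative_iff
  proof (rule LIM_zero_cancel, rule Lim_null_comparison)
    show "\<forall>\<^sub>F u in at t within {0..}. norm ((flow x u i - flow x t i) / (u - t) - F (flow x t) i) \<le> 2 * L * B * \<bar>u - t\<bar>"
      unfolding eventually_at_topological
    proof (intro exI[of _ UNIV] conjI ballI impI)
      fix u assume u: "u \<noteq> t" "u \<in> {0..}"
      have "(flow x u i - flow x t i) / (u - t) - F (flow x t) i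
          = (flow x u i - flow x t i - (u - t) * F (flow x t) i) / (u - t)"
        using u by (simp add: field_simps)
      then have "norm ((flow x u i - flow x t i) / (u - t) - F (flow x t) i)
          \<le> 2 * L * B * (u - t)\<^sup>2 / \<bar>u - t\<bar>"
        using bd[of u] u by (simp add: divide_right_mono)
      also have "\<dots> = 2 * L * B * \<bar>u - t\<bar>" using u by (simp add: power2_eq_square field_simps abs_if)
      finally show "norm ((flow x u i - flow x t i) / (u - t) - F (flow x t) i) \<le> 2 * L * B * \<bar>u - t\<bar>" .
    qed auto
    have "((\<lambda>u. 2 * L * B * \<bar>u - t\<bar>) \<longlongrightarrow> 2 * L * B * \<bar>t - t\<bar>) (at t within {0..})"
      by (intro tendsto_intros)
    then show "((\<lambda>u. 2 * L * B * \<bar>u - t\<bar>) \<longlongrightarrow> 0) (at t within {0..})" by simp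
  qed
qed

text \<open>An integer time \<open>T\<close> needs no rounding. The error does not depend on
  \<open>x\<close>, so attraction of exact solutions passes to the scheme for all starting points at
  once.\<close>

lemma euler_near_flow:
  assumes x: "x \<in> X" and k: "k \<ge> min_level"
  shows "l1_dist d (iter ((1/2) ^ k) (T * 2 ^ k) x) (flow x (real T))
    \<le> real d * (2 * flow_const (real T) * (1/2) ^ k)"
proof (rule l1_dist_coord_le)
  fix i assume i: "i < d"
  have "2 ^ k * real T = real (T * 2 ^ k)" by simp
  then have "nat \<lfloor>2 ^ k * real T\<rfloor> = T * 2 ^ k" by (simp only: floor_of_nat nat_int)
  then have "dyadic x k (real T) = iter ((1/2) ^ k) (T * 2 ^ k) x" by (simp add: dyadic_def)
  then show "\<bar>iter ((1/2) ^ k) (T * 2 ^ k) x i - flow x (real T) i\<bar> \<le> 2 * flow_const (real T) * (1/2) ^ k"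
    using dyadic_tendsto(2)[OF x _ i k, of "real T"] by simp
qed

end

section \<open>The drift on the simplex\<close>

lemma bsimplex_nonneg: "m \<in> bsimplex d \<Longrightarrow> i < d \<Longrightarrow> 0 \<le> m i"
  and bsimplex_sum: "m \<in> bsimplex d \<Longrightarrow> (\<Sum>i<d. m i) = 1"
  by (auto simp: bsimplex_def)

lemma bsimplex_partial_sum_mono:
  assumes "m \<in> bsimplex d" "i \<le> j" "j \<le> d"
  shows "(\<Sum>k<i. m k) \<le> (\<Sum>k<j. m k)"
  using assms by (intro sum_mono2) (auto simp: bsimplex_def)

lemma bsimplex_dim_pos: "m \<in> bsimplex d \<Longrightarrow> 0 < d"
  by (cases d) (auto simp: bsimplex_def)

text \<open>Partial sums increase from 0 to 1 and \<alpha> lies strictly between, so the first one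
  above \<alpha> marks the index. Monotonicity gives the uniqueness that the definite description in
  \<open>sidx\<close> requires.\<close>

lemma sidx_props:
  assumes m: "m \<in> bsimplex d" and a: "0 < \<alpha>" "\<alpha> < 1"
  defines "s \<equiv> sidx d \<alpha> m"
  shows "s < d" "(\<Sum>i<s. m i) \<le> \<alpha>" "\<alpha> < (\<Sum>i\<le>s. m i)"
proof -
  let ?P = "\<lambda>s. s < d \<and> (\<Sum>i<s. m i) \<le> \<alpha> \<and> \<alpha> < (\<Sum>i\<le>s. m i)"
  have "\<exists>!s. ?P s"
  proof (rule ex_ex1I)
    have d: "0 < d" using m by (rule bsimplex_dim_pos)
    define r where "r = (LEAST r. \<alpha> < (\<Sum>i\<le>r. m i))"
    have last: "\<alpha> < (\<Sum>i\<le>d - 1. m i)"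
      using d a bsimplex_sum[OF m] by (cases d) (auto simp: lessThan_Suc_atMost)
    have "\<alpha> < (\<Sum>i\<le>r. m i)" unfolding r_def by (rule LeastI[where P = "\<lambda>r. \<alpha> < (\<Sum>i\<le>r. m i)", OF last])
    moreover have "r \<le> d - 1" unfolding r_def by (rule Least_le[where P = "\<lambda>r. \<alpha> < (\<Sum>i\<le>r. m i)", OF last])
    moreover have "(\<Sum>i<r. m i) \<le> \<alpha>"
    proof (cases r)
      case (Suc q)
      then have "\<not> \<alpha> < (\<Sum>i\<le>q. m i)" unfolding r_def by (intro not_less_Least) auto
      then show ?thesis using Suc by (simp add: lessThan_Suc_atMost)
    qed (use a in simp)
    ultimately show "\<exists>s. ?P s" using d by (intro exI[of _ r]) auto
  next
    have no: False if "?P s" "?P s'" "s < s'" for s s'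
    proof -
      have "(\<Sum>i<Suc s. m i) \<le> (\<Sum>i<s'. m i)"
        using that m by (intro bsimplex_partial_sum_mono) auto
      then show False using that by (simp add: lessThan_Suc_atMost)
    qed
    fix s s' assume "?P s" "?P s'"
    then have "\<not> s < s'" "\<not> s' < s" using no by blast+
    then show "s = s'" by simp
  qed
  from theI'[OF this] show "s < d" "(\<Sum>i<s. m i) \<le> \<alpha>" "\<alpha> < (\<Sum>i\<le>s. m i)"
    unfolding s_def sidx_def by blast+
qed

lemma sum_split_at:
  fixes f :: "nat \<Rightarrow> 'a::comm_monoid_add"
  assumes "s < d"
  shows "(\<Sum>i<d. f i) = (\<Sum>i<s. f i) + f s + (\<Sum>i\<in>{s<..<d}. f i)"
proof -
  have "{..<d} = {..<s} \<union> insert s {s<..<d}" using assms by auto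
  moreover have "sum f ({..<s} \<union> insert s {s<..<d}) = (\<Sum>i<s. f i) + sum f (insert s {s<..<d})"
    by (rule sum.union_disjoint) auto
  moreover have "sum f (insert s {s<..<d}) = f s + (\<Sum>i\<in>{s<..<d}. f i)"
    by (rule sum.insert) auto
  ultimately show ?thesis by (simp only: add.assoc)
qed

text \<open>The mass of state \<open>i\<close> served under the priority rule; it extends to all vectors the weights
  that \<open>sidx\<close> defines piecewise on the simplex, and is manifestly Lipschitz.\<close>
definition active_mass :: "real \<Rightarrow> (nat \<Rightarrow> real) \<Rightarrow> nat \<Rightarrow> real" where
  "active_mass \<alpha> m i = min (\<Sum>k<Suc i. m k) \<alpha> - min (\<Sum>k<i. m k) \<alpha>"

lemma active_mass_sidx:
  assumes m: "m \<in> bsimplex d" and a: "0 < \<alpha>" "\<alpha> < 1" and i: "i < d"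
  defines "s \<equiv> sidx d \<alpha> m"
  shows "active_mass \<alpha> m i = (if i < s then m i else if i = s then \<alpha> - (\<Sum>k<s. m k) else 0)"
proof -
  note s = sidx_props[OF m a, folded s_def]
  consider "i < s" | "i = s" | "s < i" by linarith
  then show ?thesis
  proof cases
    case 1
    have "(\<Sum>k<Suc i. m k) \<le> (\<Sum>k<s. m k)" "(\<Sum>k<i. m k) \<le> (\<Sum>k<s. m k)"
      using 1 s(1) by (intro bsimplex_partial_sum_mono[OF m]; simp)+
    then have "min (\<Sum>k<Suc i. m k) \<alpha> = (\<Sum>k<Suc i. m k)" "min (\<Sum>k<i. m k) \<alpha> = (\<Sum>k<i. m k)"
      using s(2) by linarith+
    then show ?thesis using 1 by (simp add: active_mass_def)
  next
    case 2
    then show ?thesis using s(2,3) by (simp add: active_mass_def lessThan_Suc_atMost)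
  next
    case 3
    have "(\<Sum>k<Suc s. m k) \<le> (\<Sum>k<i. m k)" "(\<Sum>k<Suc s. m k) \<le> (\<Sum>k<Suc i. m k)"
      using 3 i by (intro bsimplex_partial_sum_mono[OF m]; simp)+
    then have "min (\<Sum>k<Suc i. m k) \<alpha> = \<alpha>" "min (\<Sum>k<i. m k) \<alpha> = \<alpha>"
      using s(3) unfolding lessThan_Suc_atMost by linarith+
    then show ?thesis using 3 by (simp add: active_mass_def)
  qed
qed

lemma active_mass_bounds:
  assumes "0 \<le> m i"
  shows "0 \<le> active_mass \<alpha> m i" "active_mass \<alpha> m i \<le> m i"
  using assms by (auto simp: active_mass_def min_def)

lemma partial_sum_lipschitz:
  assumes "i \<le> d"
  shows "\<bar>(\<Sum>k<i. m k) - (\<Sum>k<i. m' k)\<bar> \<le> l1_dist d m m'"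
proof -
  have "\<bar>(\<Sum>k<i. m k) - (\<Sum>k<i. m' k)\<bar> \<le> (\<Sum>k<i. \<bar>m k - m' k\<bar>)"
    unfolding sum_subtractf[symmetric] by (rule sum_abs)
  also have "\<dots> \<le> l1_dist d m m'"
    unfolding l1_dist_def using assms by (intro sum_mono2) auto
  finally show ?thesis .
qed

lemma active_mass_lipschitz:
  assumes "i < d"
  shows "\<bar>active_mass \<alpha> m i - active_mass \<alpha> m' i\<bar> \<le> 2 * l1_dist d m m'"
proof -
  have min_lip: "\<bar>min a \<alpha> - min b \<alpha>\<bar> \<le> \<bar>a - b\<bar>" for a b :: real by (simp add: min_def)
  have *: "\<bar>min (\<Sum>k<n. m k) \<alpha> - min (\<Sum>k<n. m' k) \<alpha>\<bar> \<le> l1_dist d m m'" if "n \<le> d" for n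
    using min_lip partial_sum_lipschitz[OF that] by (rule order_trans)
  have "active_mass \<alpha> m i - active_mass \<alpha> m' i
      = (min (\<Sum>k<Suc i. m k) \<alpha> - min (\<Sum>k<Suc i. m' k) \<alpha>) - (min (\<Sum>k<i. m k) \<alpha> - min (\<Sum>k<i. m' k) \<alpha>)"
    unfolding active_mass_def by (simp only: algebra_simps)
  then have "\<bar>active_mass \<alpha> m i - active_mass \<alpha> m' i\<bar> \<le> l1_dist d m m' + l1_dist d m m'"
    using *[of i] *[of "Suc i"] assms by (simp only: order_trans[OF abs_triangle_ineq4 add_mono])
  then show ?thesis by simp
qed

section \<open>The drift as a Lipschitz field that preserves the simplex\<close>

locale wip_bandit =
  fixes d :: nat and Q0 Q1 :: "nat \<Rightarrow> nat \<Rightarrow> real" and \<alpha> :: real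
  assumes gen0: "is_generator d Q0" and gen1: "is_generator d Q1"
    and alpha: "0 < \<alpha>" "\<alpha> < 1"
begin

text \<open>The right-hand side of the ODE, written with the generators themselves: one formula for
  all vectors in place of the pieces of \<open>phi\<close>.\<close>

definition drift :: "(nat \<Rightarrow> real) \<Rightarrow> nat \<Rightarrow> real" where
  "drift m j = (\<Sum>i<d. active_mass \<alpha> m i * Q1 i j + (m i - active_mass \<alpha> m i) * Q0 i j)"

text \<open>The summand 1 only serves to make the bound positive.\<close>
definition rate_bound :: real where
  "rate_bound = 1 + (\<Sum>i<d. \<Sum>j<d. \<bar>Q0 i j\<bar> + \<bar>Q1 i j\<bar>)"

lemma rate_bound_pos: "0 < rate_bound"
  unfolding rate_bound_def by (intro add_pos_nonneg sum_nonneg) auto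

lemma rates_le_rate_bound:
  assumes "i < d" "j < d"
  shows "\<bar>Q0 i j\<bar> + \<bar>Q1 i j\<bar> \<le> rate_bound"
proof -
  have "\<bar>Q0 i j\<bar> + \<bar>Q1 i j\<bar> \<le> (\<Sum>j<d. \<bar>Q0 i j\<bar> + \<bar>Q1 i j\<bar>)"
    using assms by (intro member_le_sum[where f = "\<lambda>j. \<bar>Q0 i j\<bar> + \<bar>Q1 i j\<bar>"]) auto
  also have "\<dots> \<le> (\<Sum>i<d. \<Sum>j<d. \<bar>Q0 i j\<bar> + \<bar>Q1 i j\<bar>)"
    using assms by (intro member_le_sum[where f = "\<lambda>i. \<Sum>j<d. \<bar>Q0 i j\<bar> + \<bar>Q1 i j\<bar>"] sum_nonneg) auto
  finally show ?thesis by (simp add: rate_bound_def)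
qed

lemma rate_weighted_sum_le:
  assumes "0 \<le> c" "\<And>i j. i < d \<Longrightarrow> j < d \<Longrightarrow> \<bar>g i j\<bar> \<le> c * (\<bar>Q0 i j\<bar> + \<bar>Q1 i j\<bar>)"
  shows "(\<Sum>j<d. \<bar>\<Sum>i<d. g i j\<bar>) \<le> c * rate_bound"
proof -
  have "(\<Sum>j<d. \<bar>\<Sum>i<d. g i j\<bar>) \<le> (\<Sum>j<d. \<Sum>i<d. c * (\<bar>Q0 i j\<bar> + \<bar>Q1 i j\<bar>))"
    by (intro sum_mono order_trans[OF sum_abs] assms(2)) auto
  also have "\<dots> = c * (\<Sum>i<d. \<Sum>j<d. \<bar>Q0 i j\<bar> + \<bar>Q1 i j\<bar>)"
    unfolding sum_distrib_left by (rule sum.swap)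
  also have "\<dots> \<le> c * rate_bound"
    using assms(1) by (intro mult_left_mono) (auto simp: rate_bound_def)
  finally show ?thesis .
qed

text \<open>The active mass of a state is 2-Lipschitz, hence its passive mass is 3-Lipschitz; the
  constant 3 covers both.\<close>

lemma drift_lipschitz: "l1_dist d (drift m) (drift m') \<le> 3 * rate_bound * l1_dist d m m'"
proof -
  let ?a = "active_mass \<alpha> m" and ?b = "active_mass \<alpha> m'"
  have eq: "drift m j - drift m' j = (\<Sum>i<d. (?a i - ?b i) * Q1 i j + ((m i - m' i) - (?a i - ?b i)) * Q0 i j)" for j
    unfolding drift_def sum_subtractf[symmetric] by (intro sum.cong) (auto simp: algebra_simps)
  have "(\<Sum>j<d. \<bar>\<Sum>i<d. (?a i - ?b i) * Q1 i j + ((m i - m' i) - (?a i - ?b i)) * Q0 i j\<bar>)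
      \<le> (3 * l1_dist d m m') * rate_bound"
  proof (rule rate_weighted_sum_le)
    fix i j assume i: "i < d" "j < d"
    let ?D = "l1_dist d m m'"
    have "\<bar>(?a i - ?b i) * Q1 i j\<bar> \<le> (3 * ?D) * \<bar>Q1 i j\<bar>"
      unfolding abs_mult using active_mass_lipschitz[OF i(1), of \<alpha> m m'] l1_dist_nonneg[of d m m']
      by (intro mult_right_mono) linarith+
    moreover have "\<bar>((m i - m' i) - (?a i - ?b i)) * Q0 i j\<bar> \<le> (3 * ?D) * \<bar>Q0 i j\<bar>"
      unfolding abs_mult using active_mass_lipschitz[OF i(1), of \<alpha> m m'] abs_diff_le_l1_dist[OF i(1), of m m']
      by (intro mult_right_mono) linarith+
    ultimately show "\<bar>(?a i - ?b i) * Q1 i j + ((m i - m' i) - (?a i - ?b i)) * Q0 i j\<bar>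
        \<le> 3 * ?D * (\<bar>Q0 i j\<bar> + \<bar>Q1 i j\<bar>)"
      unfolding distrib_left by linarith
  qed simp
  then have "l1_dist d (drift m) (drift m') \<le> (3 * l1_dist d m m') * rate_bound"
    by (simp only: l1_dist_def[of d "drift m"] eq)
  then show ?thesis by (simp only: mult_ac)
qed

lemma drift_bounded:
  assumes m: "m \<in> bsimplex d"
  shows "l1_dist d (drift m) (\<lambda>_. 0) \<le> rate_bound"
proof -
  have "(\<Sum>j<d. \<bar>\<Sum>i<d. active_mass \<alpha> m i * Q1 i j + (m i - active_mass \<alpha> m i) * Q0 i j\<bar>) \<le> 1 * rate_bound"
  proof (rule rate_weighted_sum_le)
    fix i j assume i: "i < d" "j < d"
    have "m i \<le> (\<Sum>i<d. m i)" using i m by (intro member_le_sum) (auto simp: bsimplex_def)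
    then have mi: "0 \<le> m i" "m i \<le> 1" using bsimplex_nonneg[OF m i(1)] bsimplex_sum[OF m] by auto
    then have a: "0 \<le> active_mass \<alpha> m i" "active_mass \<alpha> m i \<le> m i"
      using active_mass_bounds by blast+
    have "\<bar>active_mass \<alpha> m i * Q1 i j\<bar> \<le> 1 * \<bar>Q1 i j\<bar>"
      unfolding abs_mult using a mi by (intro mult_right_mono) auto
    moreover have "\<bar>(m i - active_mass \<alpha> m i) * Q0 i j\<bar> \<le> 1 * \<bar>Q0 i j\<bar>"
      unfolding abs_mult using a mi by (intro mult_right_mono) auto
    ultimately show "\<bar>active_mass \<alpha> m i * Q1 i j + (m i - active_mass \<alpha> m i) * Q0 i j\<bar>
        \<le> 1 * (\<bar>Q0 i j\<bar> + \<bar>Q1 i j\<bar>)" unfolding mult_1 by linarith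
  qed simp
  then show ?thesis by (simp add: l1_dist_def drift_def)
qed

lemma drift_sum_zero: "(\<Sum>j<d. drift m j) = 0"
proof -
  have "(\<Sum>j<d. drift m j)
      = (\<Sum>i<d. active_mass \<alpha> m i * (\<Sum>j<d. Q1 i j) + (m i - active_mass \<alpha> m i) * (\<Sum>j<d. Q0 i j))"
    unfolding drift_def sum_distrib_left sum.distrib[symmetric] by (rule sum.swap)
  also have "\<dots> = 0" using gen0 gen1 by (simp add: is_generator_def)
  finally show ?thesis .
qed

text \<open>Inflow is nonnegative, and state \<open>j\<close> loses mass at rate at most
  \<open>m j * rate_bound\<close>, so a step of length at most \<open>1 / rate_bound\<close> cannot
  overdraw it.\<close>

lemma drift_step_in:
  assumes m: "m \<in> bsimplex d" and h: "0 \<le> h" "h \<le> 1 / rate_bound"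
  shows "euler_step drift h m \<in> bsimplex d"
proof -
  have "0 \<le> m j + h * drift m j" if j: "j < d" for j
  proof -
    let ?a = "active_mass \<alpha> m"
    have mj: "0 \<le> m j" using m j by (rule bsimplex_nonneg)
    have a: "0 \<le> ?a i" "?a i \<le> m i" if "i < d" for i
      using active_mass_bounds bsimplex_nonneg[OF m that] by blast+
    have "drift m j = (?a j * Q1 j j + (m j - ?a j) * Q0 j j)
        + (\<Sum>i\<in>{..<d} - {j}. ?a i * Q1 i j + (m i - ?a i) * Q0 i j)"
      unfolding drift_def using j by (subst sum.remove[of _ j]) auto
    moreover have "0 \<le> (\<Sum>i\<in>{..<d} - {j}. ?a i * Q1 i j + (m i - ?a i) * Q0 i j)"
      using a j gen0 gen1 by (intro sum_nonneg add_nonneg_nonneg mult_nonneg_nonneg) (auto simp: is_generator_def)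
    moreover have "\<bar>?a j * Q1 j j\<bar> \<le> ?a j * rate_bound" "\<bar>(m j - ?a j) * Q0 j j\<bar> \<le> (m j - ?a j) * rate_bound"
      using a[OF j] rates_le_rate_bound[OF j j] by (auto simp: abs_mult intro!: mult_left_mono)
    ultimately have "- (m j * rate_bound) \<le> drift m j" by (simp add: algebra_simps)
    then have "h * (- (m j * rate_bound)) \<le> h * drift m j" using h by (intro mult_left_mono)
    moreover have "h * rate_bound \<le> 1" using h rate_bound_pos by (simp add: field_simps)
    then have "m j * (h * rate_bound) \<le> m j * 1" using mj by (intro mult_left_mono)
    ultimately show ?thesis by (simp add: algebra_simps)
  qed
  moreover have "(\<Sum>j<d. m j + h * drift m j) = 1"
    using drift_sum_zero[of m] bsimplex_sum[OF m] by (simp add: sum.distrib sum_distrib_left[symmetric])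
  ultimately show ?thesis by (simp add: bsimplex_def euler_step_def)
qed

lemma bsimplex_closed:
  assumes "\<And>k::nat. u k \<in> bsimplex d" "\<And>i. i < d \<Longrightarrow> (\<lambda>k. u k i) \<longlonglongrightarrow> v i"
  shows "v \<in> bsimplex d"
proof -
  have "0 \<le> v i" if "i < d" for i
    using assms(2)[OF that] assms(1) that by (intro LIMSEQ_le_const) (auto simp: bsimplex_def)
  moreover have "(\<Sum>i<d. v i) = 1"
  proof (rule LIMSEQ_unique)
    show "(\<lambda>k. \<Sum>i<d. u k i) \<longlonglongrightarrow> (\<Sum>i<d. v i)" using assms(2) by (intro tendsto_sum) auto
    show "(\<lambda>k. \<Sum>i<d. u k i) \<longlonglongrightarrow> 1" using assms(1) by (simp add: bsimplex_def)
  qed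
  ultimately show ?thesis by (simp add: bsimplex_def)
qed

sublocale lipschitz_field d drift "bsimplex d" "3 * rate_bound" rate_bound "1 / rate_bound"
proof
  show "v \<in> bsimplex d" if "\<And>k. u k \<in> bsimplex d" "\<And>i. i < d \<Longrightarrow> (\<lambda>k. u k i) \<longlonglongrightarrow> v i" for u v
    using that by (rule bsimplex_closed)
qed (use rate_bound_pos drift_lipschitz drift_bounded drift_step_in in auto)

lemma tau_bound:
  assumes "i < d"
  shows "\<bar>Q0 i i\<bar> \<le> tau d Q0 Q1" "\<bar>Q1 i i\<bar> \<le> tau d Q0 Q1"
proof -
  have "max \<bar>Q0 i i\<bar> \<bar>Q1 i i\<bar> \<le> tau d Q0 Q1"
    unfolding tau_def using assms by (intro Max_ge) auto
  then show "\<bar>Q0 i i\<bar> \<le> tau d Q0 Q1" "\<bar>Q1 i i\<bar> \<le> tau d Q0 Q1" by auto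
qed

text \<open>For \<open>t = 0\<close> the junk values of \<open>Pmat\<close> are harmless, because then \<open>Q\<close> vanishes.\<close>
lemma Pmat_uniformization:
  assumes Q: "is_generator d Q" and ij: "i < d" "j < d" and t: "\<bar>Q i i\<bar> \<le> t"
  shows "t * Pmat d t Q i j = Q i j + (if i = j then t else 0)"
proof -
  have row: "Q i i + (\<Sum>k\<in>{..<d} - {i}. Q i k) = 0"
    using Q ij by (simp add: is_generator_def sum.remove[of "{..<d}" i, symmetric])
  show ?thesis
  proof (cases "t = 0")
    case True
    with t have "Q i i = 0" by simp
    with row have "(\<Sum>k\<in>{..<d} - {i}. Q i k) = 0" by simp
    then have "\<forall>k\<in>{..<d} - {i}. Q i k = 0"
      using Q ij by (subst (asm) sum_nonneg_eq_0_iff) (auto simp: is_generator_def)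
    then have "Q i j = 0" using ij \<open>Q i i = 0\<close> by (cases "i = j") auto
    then show ?thesis using True by simp
  next
    case False
    then show ?thesis using row
      by (auto simp: Pmat_def sum_divide_distrib[symmetric] right_diff_distrib)
  qed
qed

text \<open>Uniformization adds \<open>tau\<close> on the diagonal under both actions. The active
  and passive weights of state \<open>j\<close> add up to \<open>m j\<close>, which accounts for the
  term \<open>- m j\<close>.\<close>

lemma drift_eq_phi:
  assumes m: "m \<in> bsimplex d" and j: "j < d"
  shows "drift m j = tau d Q0 Q1 * (phi d Q0 Q1 \<alpha> m j - m j)"
proof -
  define t where "t = tau d Q0 Q1"
  define s where "s = sidx d \<alpha> m"
  let ?a = "active_mass \<alpha> m"
  let ?P0 = "Pmat d t Q0" and ?P1 = "Pmat d t Q1"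
  let ?f = "\<lambda>i. ?a i * ?P1 i j + (m i - ?a i) * ?P0 i j"
  note s = sidx_props[OF m alpha, folded s_def]
  have a: "?a i = (if i < s then m i else if i = s then \<alpha> - (\<Sum>k<s. m k) else 0)" if "i < d" for i
    using active_mass_sidx[OF m alpha that] by (simp add: s_def)
  have "(\<Sum>i<s. ?f i) = (\<Sum>i<s. m i * ?P1 i j)" using s(1) by (intro sum.cong) (auto simp: a)
  moreover have "(\<Sum>i\<in>{s<..<d}. ?f i) = (\<Sum>i\<in>{s<..<d}. m i * ?P0 i j)" by (intro sum.cong) (auto simp: a)
  moreover have "?f s = (\<alpha> - (\<Sum>i<s. m i)) * ?P1 s j + ((\<Sum>i\<le>s. m i) - \<alpha>) * ?P0 s j"
    using s(1) by (simp add: a lessThan_Suc_atMost[symmetric] algebra_simps)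
  ultimately have phi: "phi d Q0 Q1 \<alpha> m j = (\<Sum>i<d. ?f i)"
    by (simp add: phi_def Let_def t_def[symmetric] s_def[symmetric] sum_split_at[OF s(1)])
  have Q: "Q0 i j = t * ?P0 i j - (if i = j then t else 0)" "Q1 i j = t * ?P1 i j - (if i = j then t else 0)"
    if "i < d" for i
    using Pmat_uniformization[OF gen0 that j] Pmat_uniformization[OF gen1 that j] tau_bound[OF that]
    by (auto simp: t_def)
  have "drift m j = (\<Sum>i<d. t * ?f i - (if i = j then t * m j else 0))"
    unfolding drift_def by (intro sum.cong) (auto simp: Q algebra_simps)
  also have "\<dots> = t * phi d Q0 Q1 \<alpha> m j - t * m j"
    using j by (simp add: sum_subtractf sum_distrib_left phi)
  finally show ?thesis by (simp add: t_def right_diff_distrib)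
qed

lemma flow_ode_solution:
  assumes "m \<in> bsimplex d"
  shows "ode_solution d Q0 Q1 \<alpha> (flow m)"
  unfolding ode_solution_def
  using flow_in[OF assms] flow_has_derivative[OF assms] by (simp add: drift_eq_phi)

lemma euler_attraction:
  assumes attr: "uniform_global_attractor d Q0 Q1 \<alpha> mstar" and R: "0 < R"
  obtains T K where "0 < T"
    and "\<And>k m. K \<le> k \<Longrightarrow> m \<in> bsimplex d \<Longrightarrow> l1_dist d (iter ((1/2) ^ k) (T * 2 ^ k) m) mstar \<le> R"
proof -
  \<comment> \<open>The attractor is stated coordinatewise, so \<open>l1_dist\<close> costs a factor
    \<open>real d\<close>. The flow uses up half of \<open>R\<close>, the distance of the scheme
    from the flow the other half.\<close>
  define \<epsilon> where "\<epsilon> = R / (2 * (real d + 1))"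
  have \<epsilon>: "0 < \<epsilon>" "real d * \<epsilon> \<le> R / 2" using R by (auto simp: \<epsilon>_def field_simps)
  obtain T0 where T0: "\<And>x t i. ode_solution d Q0 Q1 \<alpha> x \<Longrightarrow> T0 \<le> t \<Longrightarrow> i < d \<Longrightarrow> \<bar>x t i - mstar i\<bar> \<le> \<epsilon>"
    using attr \<epsilon>(1) unfolding uniform_global_attractor_def by blast
  define T where "T = Suc (nat \<lceil>T0\<rceil>)"
  have T: "T0 \<le> real T" unfolding T_def by linarith
  define c where "c = real d * (2 * flow_const (real T))"
  have c: "0 \<le> c" using flow_const_nonneg[of "real T"] by (simp add: c_def)
  obtain K where K: "\<And>k. K \<le> k \<Longrightarrow> (1/2::real) ^ k \<le> R / (2 * (c + 1))"
    using mesh_small[of "R / (2 * (c + 1))"] R c by auto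
  show thesis
  proof (rule that)
    show "0 < T" by (simp add: T_def)
    fix k m assume k: "max K min_level \<le> k" and m: "m \<in> bsimplex d"
    have "l1_dist d (flow m (real T)) mstar \<le> real d * \<epsilon>"
      using T0[OF flow_ode_solution[OF m] T] by (rule l1_dist_coord_le)
    moreover have "l1_dist d (iter ((1/2) ^ k) (T * 2 ^ k) m) (flow m (real T)) \<le> c * (1/2) ^ k"
      using euler_near_flow[OF m, of k T] k by (simp add: c_def mult_ac)
    moreover have "c * (1/2) ^ k \<le> c * (R / (2 * (c + 1)))"
      using K[of k] k c by (intro mult_left_mono) auto
    moreover have "c * (R / (2 * (c + 1))) \<le> R / 2" using c R by (simp add: field_simps)
    ultimately show "l1_dist d (iter ((1/2) ^ k) (T * 2 ^ k) m) mstar \<le> R"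
      using l1_dist_triangle[of d "iter ((1/2) ^ k) (T * 2 ^ k) m" mstar "flow m (real T)"] \<epsilon>(2) by linarith
  qed
qed

end

section \<open>Stationary balance\<close>

definition fractions :: "nat \<Rightarrow> (nat \<Rightarrow> nat) \<Rightarrow> nat \<Rightarrow> real" where
  "fractions N x i = real (x i) / real N"

lemma fractions_in_bsimplex:
  assumes "x \<in> configs d N" "1 \<le> N"
  shows "fractions N x \<in> bsimplex d"
proof -
  have "(\<Sum>i<d. real (x i)) = real N" using assms by (simp add: configs_def flip: of_nat_sum)
  then show ?thesis
    using assms(2) by (simp add: bsimplex_def fractions_def sum_divide_distrib[symmetric])
qed

lemma move_in_configs:
  assumes x: "x \<in> configs d N" and ij: "i < d" "j < d" "i \<noteq> j" and pos: "0 < x i"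
  shows "move x i j \<in> configs d N"
proof -
  have split: "(\<Sum>k<d. z k) = z i + (z j + (\<Sum>k\<in>{..<d} - {i} - {j}. z k))" for z :: "nat \<Rightarrow> nat"
    using ij by (simp add: sum.remove[of "{..<d}" i] sum.remove[of "{..<d} - {i}" j])
  have "(\<Sum>k\<in>{..<d} - {i} - {j}. move x i j k) = (\<Sum>k\<in>{..<d} - {i} - {j}. x k)"
    by (intro sum.cong) (auto simp: move_def)
  then have "(\<Sum>k<d. move x i j k) = (\<Sum>k<d. x k)"
    using ij pos unfolding split by (simp add: move_def)
  then show ?thesis using x ij by (auto simp: configs_def move_def)
qed

lemma fractions_move:
  assumes "0 < x i" "i \<noteq> j"
  shows "fractions N (move x i j)
    = (fractions N x)(i := fractions N x i - 1 / real N, j := fractions N x j + 1 / real N)"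
  using assms by (intro ext) (auto simp: fractions_def move_def diff_divide_distrib add_divide_distrib)

text \<open>With \<open>S i\<close> the number of bandits in states below \<open>i\<close>, the
  truncated difference in \<open>wip_active\<close> equals
  \<open>min (S (Suc i)) K - min (S i) K\<close>. Scaling by \<open>N\<close> turns the cap
  \<open>K\<close> into \<alpha>.\<close>

lemma wip_active_eq_active_mass:
  assumes N: "1 \<le> N" and K: "\<alpha> * real N = real K"
  shows "real (wip_active K x i) = real N * active_mass \<alpha> (fractions N x) i"
    and "real (x i - wip_active K x i) = real N * (fractions N x i - active_mass \<alpha> (fractions N x) i)"
proof -
  have scale: "real N * min (\<Sum>k<n. fractions N x k) \<alpha> = real (min (\<Sum>k<n. x k) K)" for n
  proof -
    have "real N * min (\<Sum>k<n. fractions N x k) \<alpha> = min (real N * (\<Sum>k<n. fractions N x k)) (real N * \<alpha>)"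
      by (simp add: min_mult_distrib_left)
    also have "real N * (\<Sum>k<n. fractions N x k) = real (\<Sum>k<n. x k)"
      using N by (simp add: fractions_def sum_divide_distrib[symmetric])
    also have "real N * \<alpha> = real K" using K by (simp add: mult.commute)
    finally show ?thesis by (simp only: of_nat_min)
  qed
  have "real (wip_active K x i) = real (min (\<Sum>k<Suc i. x k) K) - real (min (\<Sum>k<i. x k) K)"
    by (auto simp: wip_active_def min_def)
  also have "\<dots> = real N * active_mass \<alpha> (fractions N x) i"
    unfolding active_mass_def right_diff_distrib scale ..
  finally show 1: "real (wip_active K x i) = real N * active_mass \<alpha> (fractions N x) i" .
  have "wip_active K x i \<le> x i" by (simp add: wip_active_def)
  then show "real (x i - wip_active K x i) = real N * (fractions N x i - active_mass \<alpha> (fractions N x) i)"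
    using N 1 by (simp add: fractions_def right_diff_distrib)
qed

text \<open>A sum over an infinite set is 0 by convention, whereas \<open>p\<close> sums to
  1.\<close>

lemma wip_stationary_finite: "wip_stationary d Q0 Q1 N K p \<Longrightarrow> finite (configs d N)"
  unfolding wip_stationary_def by (metis sum.infinite zero_neq_one)

lemma wip_stationary_generator:
  assumes st: "wip_stationary d Q0 Q1 N K p"
  shows "(\<Sum>x\<in>configs d N. p x * (\<Sum>y\<in>configs d N - {x}. wip_rate d Q0 Q1 K x y * (f y - f x))) = 0"
proof -
  let ?C = "configs d N" and ?r = "wip_rate d Q0 Q1 K"
  have fin: "finite ?C" using st by (rule wip_stationary_finite)
  \<comment> \<open>Padding with a zero diagonal makes the inner index set independent of the outer
    index, so that \<open>sum.swap\<close> applies and global balance can be inserted.\<close>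
  have off: "(\<Sum>x\<in>?C - {y}. g x) = (\<Sum>x\<in>?C. if x = y then 0 else g x)" for y and g :: "_ \<Rightarrow> real"
    using fin by (intro sum.mono_neutral_cong_left) auto
  have "(\<Sum>x\<in>?C. p x * (\<Sum>y\<in>?C - {x}. ?r x y * f y))
      = (\<Sum>x\<in>?C. \<Sum>y\<in>?C. if x = y then 0 else p x * ?r x y * f y)"
    unfolding off sum_distrib_left by (intro sum.cong) auto
  also have "\<dots> = (\<Sum>y\<in>?C. \<Sum>x\<in>?C. if x = y then 0 else p x * ?r x y * f y)"
    by (rule sum.swap)
  also have "\<dots> = (\<Sum>y\<in>?C. f y * (\<Sum>x\<in>?C - {y}. p x * ?r x y))"
    unfolding off sum_distrib_left by (intro sum.cong) auto
  also have "\<dots> = (\<Sum>y\<in>?C. f y * (p y * (\<Sum>z\<in>?C - {y}. ?r y z)))"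
    using st by (intro sum.cong) (auto simp: wip_stationary_def)
  also have "\<dots> = (\<Sum>x\<in>?C. p x * (\<Sum>y\<in>?C - {x}. ?r x y * f x))"
    unfolding sum_distrib_left by (simp add: mult_ac)
  finally show ?thesis
    by (simp add: right_diff_distrib sum_subtractf)
qed

context wip_bandit
begin

text \<open>For distinct states this is the jump rate of the chain divided by \<open>N\<close>. The
  diagonal values make the rows sum to 0.\<close>

definition flux :: "(nat \<Rightarrow> real) \<Rightarrow> nat \<Rightarrow> nat \<Rightarrow> real" where
  "flux m i j = active_mass \<alpha> m i * Q1 i j + (m i - active_mass \<alpha> m i) * Q0 i j"

lemma flux_nonneg:
  assumes "m \<in> bsimplex d" "i < d" "j < d" "i \<noteq> j"
  shows "0 \<le> flux m i j"
  unfolding flux_def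
  using active_mass_bounds[of m i \<alpha>] bsimplex_nonneg[OF assms(1,2)] assms gen0 gen1
  by (intro add_nonneg_nonneg mult_nonneg_nonneg) (auto simp: is_generator_def)

lemma flux_total:
  assumes m: "m \<in> bsimplex d"
  shows "(\<Sum>i<d. \<Sum>j\<in>{..<d} - {i}. flux m i j) \<le> rate_bound"
proof -
  have "flux m i j \<le> \<bar>Q0 i j\<bar> + \<bar>Q1 i j\<bar>" if i: "i < d" for i j
  proof -
    have "m i \<le> (\<Sum>i<d. m i)" using i m by (intro member_le_sum) (auto simp: bsimplex_def)
    then have a: "0 \<le> m i" "m i \<le> 1" "0 \<le> active_mass \<alpha> m i" "active_mass \<alpha> m i \<le> m i"
      using bsimplex_nonneg[OF m i] bsimplex_sum[OF m] active_mass_bounds[of m i \<alpha>] by auto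
    have "c * q \<le> \<bar>q\<bar>" if "0 \<le> c" "c \<le> 1" for c q :: real
    proof -
      have "c * q \<le> c * \<bar>q\<bar>" using that by (intro mult_left_mono) auto
      also have "\<dots> \<le> 1 * \<bar>q\<bar>" using that by (intro mult_right_mono) auto
      finally show ?thesis by simp
    qed
    from this[of "active_mass \<alpha> m i" "Q1 i j"] this[of "m i - active_mass \<alpha> m i" "Q0 i j"] a
    have "active_mass \<alpha> m i * Q1 i j \<le> \<bar>Q1 i j\<bar>" "(m i - active_mass \<alpha> m i) * Q0 i j \<le> \<bar>Q0 i j\<bar>"
      by auto
    then show ?thesis unfolding flux_def by linarith
  qed
  then have "(\<Sum>i<d. \<Sum>j\<in>{..<d} - {i}. flux m i j) \<le> (\<Sum>i<d. \<Sum>j\<in>{..<d} - {i}. \<bar>Q0 i j\<bar> + \<bar>Q1 i j\<bar>)"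
    by (intro sum_mono) auto
  also have "\<dots> \<le> (\<Sum>i<d. \<Sum>j<d. \<bar>Q0 i j\<bar> + \<bar>Q1 i j\<bar>)"
    by (intro sum_mono sum_mono2) auto
  finally show ?thesis by (simp add: rate_bound_def)
qed

text \<open>The diagonal adds nothing to differences \<open>v j - v i\<close>, and with it the rows
  of \<open>flux\<close> sum to 0, so only the inflow term remains. On linear functions the
  generator is thus the pairing with the drift.\<close>

lemma flux_pairing:
  "(\<Sum>i<d. \<Sum>j\<in>{..<d} - {i}. flux m i j * (v j - v i)) = (\<Sum>j<d. v j * drift m j)"
proof -
  have row: "(\<Sum>j<d. flux m i j) = 0" if "i < d" for i
    using gen0 gen1 that
    by (simp add: flux_def sum.distrib is_generator_def flip: sum_distrib_left)
  have "(\<Sum>j\<in>{..<d} - {i}. flux m i j * (v j - v i)) = (\<Sum>j<d. flux m i j * v j)" if "i < d" for i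
  proof -
    have "(\<Sum>j\<in>{..<d} - {i}. flux m i j * (v j - v i)) = (\<Sum>j<d. flux m i j * (v j - v i))"
      using that by (intro sum.mono_neutral_left) auto
    also have "\<dots> = (\<Sum>j<d. flux m i j * v j) - (\<Sum>j<d. flux m i j) * v i"
      by (simp add: right_diff_distrib sum_subtractf sum_distrib_right)
    finally show ?thesis using row[OF that] by simp
  qed
  then have "(\<Sum>i<d. \<Sum>j\<in>{..<d} - {i}. flux m i j * (v j - v i)) = (\<Sum>i<d. \<Sum>j<d. flux m i j * v j)"
    by simp
  also have "\<dots> = (\<Sum>j<d. \<Sum>i<d. flux m i j * v j)" by (rule sum.swap)
  also have "\<dots> = (\<Sum>j<d. v j * drift m j)"
    by (simp add: drift_def flux_def sum_distrib_left mult.commute)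
  finally show ?thesis .
qed

lemma stationary_balance:
  fixes g :: "(nat \<Rightarrow> real) \<Rightarrow> real"
  assumes N: "1 \<le> N" and K: "\<alpha> * real N = real K" and st: "wip_stationary d Q0 Q1 N K p"
  shows "(\<Sum>x\<in>configs d N. p x * (let m = fractions N x in \<Sum>i<d. \<Sum>j\<in>{..<d} - {i}.
      flux m i j * (g (m(i := m i - 1 / real N, j := m j + 1 / real N)) - g m))) = 0"
proof -
  let ?C = "configs d N"
  have fin: "finite ?C" using st by (rule wip_stationary_finite)
  define f where "f x = g (fractions N x)" for x
  define G where "G x = (let m = fractions N x in \<Sum>i<d. \<Sum>j\<in>{..<d} - {i}.
      flux m i j * (g (m(i := m i - 1 / real N, j := m j + 1 / real N)) - g m))" for x
  have "(\<Sum>y\<in>?C - {x}. wip_rate d Q0 Q1 K x y * (f y - f x)) = real N * G x" if x: "x \<in> ?C" for x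
  proof -
    let ?m = "fractions N x"
    define \<rho> where "\<rho> i j = real (wip_active K x i) * Q1 i j + real (x i - wip_active K x i) * Q0 i j" for i j
    have \<rho>: "\<rho> i j = real N * flux ?m i j" for i j
      unfolding \<rho>_def flux_def wip_active_eq_active_mass[OF N K] by (simp add: algebra_simps)
    have "(\<Sum>y\<in>?C - {x}. wip_rate d Q0 Q1 K x y * (f y - f x))
        = (\<Sum>y\<in>?C - {x}. \<Sum>i<d. \<Sum>j\<in>{..<d} - {i}. if y = move x i j then \<rho> i j * (f y - f x) else 0)"
      unfolding wip_rate_def \<rho>_def[symmetric] sum_distrib_right by (intro sum.cong refl) auto
    also have "\<dots> = (\<Sum>i<d. \<Sum>y\<in>?C - {x}. \<Sum>j\<in>{..<d} - {i}. if y = move x i j then \<rho> i j * (f y - f x) else 0)"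
      by (rule sum.swap)
    also have "\<dots> = (\<Sum>i<d. \<Sum>j\<in>{..<d} - {i}. \<Sum>y\<in>?C - {x}. if y = move x i j then \<rho> i j * (f y - f x) else 0)"
      by (intro sum.cong refl sum.swap)
    also have "\<dots> = (\<Sum>i<d. \<Sum>j\<in>{..<d} - {i}.
        real N * (flux ?m i j * (g (?m(i := ?m i - 1 / real N, j := ?m j + 1 / real N)) - g ?m)))"
    proof (intro sum.cong refl)
      fix i j assume i: "i \<in> {..<d}" and j: "j \<in> {..<d} - {i}"
      show "(\<Sum>y\<in>?C - {x}. if y = move x i j then \<rho> i j * (f y - f x) else 0)
          = real N * (flux ?m i j * (g (?m(i := ?m i - 1 / real N, j := ?m j + 1 / real N)) - g ?m))"
      \<comment> \<open>If state \<open>i\<close> is empty, natural subtraction makes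
        \<open>move\<close> leave the configurations, and \<open>g\<close> is evaluated off the
        simplex. The vanishing rate removes both terms.\<close>
      proof (cases "x i = 0")
        case True
        then have "\<rho> i j = 0" by (simp add: \<rho>_def wip_active_def)
        moreover from this have "flux ?m i j = 0" using N by (simp add: \<rho>)
        ultimately show ?thesis by (simp cong: if_cong)
      next
        case False
        then have "move x i j \<in> ?C" using i j by (intro move_in_configs[OF x]) auto
        then have "(\<Sum>y\<in>?C - {x}. if y = move x i j then \<rho> i j * (f y - f x) else 0)
            = \<rho> i j * (f (move x i j) - f x)"
          using fin by (auto)
        then show ?thesis using False j by (simp add: \<rho> f_def fractions_move)
      qed
    qed
    also have "\<dots> = real N * G x" by (simp add: G_def Let_def sum_distrib_left)
    finally show ?thesis .
  qed
  then have "(\<Sum>x\<in>?C. p x * (real N * G x)) = 0"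
    using wip_stationary_generator[OF st, of f] by simp
  then have "real N * (\<Sum>x\<in>?C. p x * G x) = 0"
    by (simp add: sum_distrib_left mult_ac)
  then show ?thesis using N by (simp add: G_def)
qed

text \<open>A coordinate is a linear function, so the generator turns it into the drift exactly,
  with no remainder in \<open>1 / N\<close>.\<close>

lemma stationary_mean_drift:
  assumes N: "1 \<le> N" and K: "\<alpha> * real N = real K" and st: "wip_stationary d Q0 Q1 N K p"
    and l: "l < d"
  shows "(\<Sum>x\<in>configs d N. p x * drift (fractions N x) l) = 0"
proof -
  have "(\<Sum>i<d. \<Sum>j\<in>{..<d} - {i}. flux m i j * ((m(i := m i - 1 / real N, j := m j + 1 / real N)) l - m l))
      = drift m l / real N" for m
  proof -
    let ?v = "\<lambda>j. if j = l then 1 / real N else 0"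
    have "(\<Sum>i<d. \<Sum>j\<in>{..<d} - {i}. flux m i j * ((m(i := m i - 1 / real N, j := m j + 1 / real N)) l - m l))
        = (\<Sum>i<d. \<Sum>j\<in>{..<d} - {i}. flux m i j * (?v j - ?v i))"
      by (intro sum.cong refl) auto
    also have "\<dots> = (\<Sum>j<d. ?v j * drift m j)" by (rule flux_pairing)
    also have "\<dots> = (\<Sum>j<d. if j = l then drift m j / real N else 0)" by (intro sum.cong) auto
    also have "\<dots> = drift m l / real N" using l by (simp)
    finally show ?thesis .
  qed
  then have "(\<Sum>x\<in>configs d N. p x * (drift (fractions N x) l / real N)) = 0"
    using stationary_balance[OF N K st, of "\<lambda>m. m l"] by (simp only: Let_def)
  then show ?thesis using N by (simp add: sum_divide_distrib[symmetric])
qed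

end

section \<open>Lyapunov functions and concentration\<close>

lemma exp_le_quadratic:
  fixes u :: real
  assumes "\<bar>u\<bar> \<le> 1"
  shows "exp u \<le> 1 + u + u\<^sup>2"
proof (cases "0 \<le> u")
  case True
  then show ?thesis using exp_bound[of u] assms by simp
next
  case False
  define v where "v = - u"
  have v: "0 \<le> v" "v \<le> 1" using False assms by (auto simp: v_def)
  \<comment> \<open>The product on the right is \<open>1 + v ^ 3\<close>.\<close>
  have "1 \<le> (1 - v + v\<^sup>2) * (1 + v)"
    using v by (simp add: power2_eq_square algebra_simps)
  also have "\<dots> \<le> (1 - v + v\<^sup>2) * exp v"
  proof (rule mult_left_mono)
    show "1 + v \<le> exp v" by (rule exp_ge_add_one_self)
    show "0 \<le> 1 - v + v\<^sup>2" using v by (intro add_nonneg_nonneg) auto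
  qed
  finally have "exp (- v) \<le> 1 - v + v\<^sup>2"
    by (simp add: exp_minus field_simps)
  then show ?thesis by (simp add: v_def)
qed

text \<open>The parabola uses squares because their increments under a jump or an Euler step are
  explicit polynomials; \<open>l1_dist_sq_le\<close> leads back to \<open>l1_dist\<close>.\<close>

definition sq_dist :: "nat \<Rightarrow> (nat \<Rightarrow> real) \<Rightarrow> (nat \<Rightarrow> real) \<Rightarrow> real" where
  "sq_dist d x y = (\<Sum>i<d. (x i - y i)\<^sup>2)"

lemma sq_dist_nonneg [simp]: "0 \<le> sq_dist d x y"
  by (simp add: sq_dist_def sum_nonneg)

lemma l1_dist_sq_le: "(l1_dist d x y)\<^sup>2 \<le> real d * sq_dist d x y"
  using Cauchy_Schwarz_ineq_sum[of "\<lambda>_. 1" "\<lambda>i. \<bar>x i - y i\<bar>" "{..<d}"]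
  by (simp add: l1_dist_def sq_dist_def)

lemma sq_dist_shift:
  assumes "i < d" "j < d" "i \<noteq> j"
  shows "sq_dist d (m(i := m i - \<delta>, j := m j + \<delta>)) y
    = sq_dist d m y + 2 * \<delta> * ((m j - y j) - (m i - y i)) + 2 * \<delta>\<^sup>2"
proof -
  have split: "(\<Sum>k<d. z k) = z i + (z j + (\<Sum>k\<in>{..<d} - {i} - {j}. z k))" for z :: "nat \<Rightarrow> real"
    using assms by (simp add: sum.remove[of "{..<d}" i] sum.remove[of "{..<d} - {i}" j])
  have "(\<Sum>k\<in>{..<d} - {i} - {j}. ((m(i := m i - \<delta>, j := m j + \<delta>)) k - y k)\<^sup>2)
      = (\<Sum>k\<in>{..<d} - {i} - {j}. (m k - y k)\<^sup>2)"
    by (intro sum.cong) auto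
  then show ?thesis
    using assms unfolding sq_dist_def split by (simp add: power2_eq_square algebra_simps)
qed

lemma sq_dist_euler_step:
  "sq_dist d m (euler_step F h y)
    = sq_dist d m y - 2 * h * (\<Sum>i<d. (m i - y i) * F y i) + h\<^sup>2 * (\<Sum>i<d. (F y i)\<^sup>2)"
  by (simp add: sq_dist_def euler_step_def sum_distrib_left sum_subtractf[symmetric] sum.distrib[symmetric])
    (intro sum.cong refl, simp add: power2_eq_square algebra_simps)

locale euler_lyapunov = wip_bandit +
  fixes V :: "(nat \<Rightarrow> real) \<Rightarrow> real" and l \<kappa> h \<epsilon> :: real
  assumes V_nonneg: "\<And>m. m \<in> bsimplex d \<Longrightarrow> 0 \<le> V m"
    and V_lip: "\<And>x y. x \<in> bsimplex d \<Longrightarrow> y \<in> bsimplex d \<Longrightarrow> V x \<le> V y + l * l1_dist d x y"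
    and V_step: "\<And>y. y \<in> bsimplex d \<Longrightarrow> V (euler_step drift h y) \<le> V y - h * \<kappa> * V y"
    and l_nonneg: "0 \<le> l" and \<kappa>_pos: "0 < \<kappa>"
    and h_pos: "0 < h" and h_le: "h \<le> 1 / rate_bound" and \<epsilon>_pos: "0 < \<epsilon>"
begin

text \<open>The inf-convolution of \<open>V\<close> with a parabola is semiconcave, so its increments along the
  jumps of the chain are bounded above by a linear functional up to second order. This replaces
  smoothness, which \<open>V\<close> lacks.\<close>
definition envelope :: "(nat \<Rightarrow> real) \<Rightarrow> real" where
  "envelope m = (INF y\<in>bsimplex d. V y + sq_dist d m y / (2 * \<epsilon>))"

lemma envelope_le: "y \<in> bsimplex d \<Longrightarrow> envelope m \<le> V y + sq_dist d m y / (2 * \<epsilon>)"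
  unfolding envelope_def using V_nonneg \<epsilon>_pos
  by (intro cINF_lower bdd_belowI[of _ 0]) auto

lemma envelope_le_self: "m \<in> bsimplex d \<Longrightarrow> envelope m \<le> V m"
  using envelope_le[of m m] by (simp add: sq_dist_def)

text \<open>If \<open>y\<close> minimises up to \<eta> and \<open>z\<close> is its distance from
  \<open>m\<close>, then \<open>z^2 / (2 * d * \<epsilon>) <= l * z + \<eta>\<close>. For
  \<open>\<eta> <= \<epsilon> <= z\<close> this forces
  \<open>z <= 2 * d * (l + 1) * \<epsilon>\<close>; division by \<epsilon> gives the slope.\<close>

definition slope_bound :: real where
  "slope_bound = 2 * real d * (l + 1)"

text \<open>The slope is \<open>v = (m - y) / \<epsilon>\<close> for a near-minimiser
  \<open>y\<close>; the slack \<eta> stands in for attainment of the infimum. Keeping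
  \<open>y\<close> as competitor at a shifted point bounds jumps, even those that leave the
  simplex.\<close>

lemma envelope_slope:
  assumes m: "m \<in> bsimplex d" and \<eta>: "0 < \<eta>" "\<eta> \<le> \<epsilon>"
  obtains v where
    "\<And>i j \<delta>. i < d \<Longrightarrow> j < d \<Longrightarrow> i \<noteq> j \<Longrightarrow>
      envelope (m(i := m i - \<delta>, j := m j + \<delta>)) \<le> envelope m + \<delta> * (v j - v i) + \<delta>\<^sup>2 / \<epsilon> + \<eta>"
    "\<And>i. i < d \<Longrightarrow> \<bar>v i\<bar> \<le> slope_bound"
    "(\<Sum>j<d. v j * drift m j) \<le> - \<kappa> * V m + (\<kappa> * l * slope_bound + 3 * rate_bound * slope_bound\<^sup>2) * \<epsilon>
      + h * rate_bound\<^sup>2 / (2 * \<epsilon>) + \<eta> / h"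
    "V m \<le> envelope m + l * slope_bound * \<epsilon> + \<eta>"
proof -
  let ?X = "bsimplex d" and ?C = slope_bound
  have ne: "(\<lambda>y. V y + sq_dist d m y / (2 * \<epsilon>)) ` ?X \<noteq> {}" using m by auto
  obtain y where y: "y \<in> ?X" and near: "V y + sq_dist d m y / (2 * \<epsilon>) < envelope m + \<eta>"
    using cInf_lessD[OF ne, of "envelope m + \<eta>"] \<eta> by (auto simp: envelope_def)
  define z where "z = l1_dist d m y"
  have z0: "0 \<le> z" by (simp add: z_def)
  have d: "1 \<le> real d" using bsimplex_dim_pos[OF m] by simp
  have C: "2 \<le> ?C" "0 \<le> ?C" using d l_nonneg mult_mono[of 1 "real d" 1 "l + 1"] by (auto simp: slope_bound_def)
  have z: "z \<le> ?C * \<epsilon>"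
  proof (rule ccontr)
    assume "\<not> ?thesis"
    then have big: "?C * \<epsilon> < z" by simp
    then have ez: "\<epsilon> \<le> z" using C \<epsilon>_pos mult_mono[of 1 ?C \<epsilon> \<epsilon>] by linarith
    have "V y + sq_dist d m y / (2 * \<epsilon>) \<le> V y + l * z + \<eta>"
      using near envelope_le_self[OF m] V_lip[OF m y] by (simp add: z_def)
    then have "sq_dist d m y \<le> 2 * \<epsilon> * (l * z + \<eta>)" using \<epsilon>_pos by (simp add: field_simps)
    also have "\<dots> \<le> 2 * \<epsilon> * (l * z + z)" using \<epsilon>_pos \<eta> ez by (intro mult_left_mono) auto
    finally have "real d * sq_dist d m y \<le> real d * (2 * \<epsilon> * (l * z + z))" by (intro mult_left_mono) auto
    then have "z\<^sup>2 \<le> (?C * \<epsilon>) * z"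
      using l1_dist_sq_le[of d m y] by (simp add: z_def slope_bound_def algebra_simps)
    then show False using big ez \<epsilon>_pos by (simp add: power2_eq_square)
  qed
  define v where "v i = (m i - y i) / \<epsilon>" for i
  show thesis
  proof (rule that)
    fix i j \<delta> assume ij: "i < d" "j < d" "i \<noteq> j"
    have "envelope (m(i := m i - \<delta>, j := m j + \<delta>)) \<le> V y + sq_dist d (m(i := m i - \<delta>, j := m j + \<delta>)) y / (2 * \<epsilon>)"
      by (rule envelope_le[OF y])
    also have "\<dots> = V y + sq_dist d m y / (2 * \<epsilon>) + \<delta> * (v j - v i) + \<delta>\<^sup>2 / \<epsilon>"
      unfolding sq_dist_shift[OF ij] using \<epsilon>_pos by (simp add: v_def field_simps)
    finally show "envelope (m(i := m i - \<delta>, j := m j + \<delta>)) \<le> envelope m + \<delta> * (v j - v i) + \<delta>\<^sup>2 / \<epsilon> + \<eta>"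
      using near by linarith
  next
    fix i assume i: "i < d"
    have "\<bar>m i - y i\<bar> \<le> ?C * \<epsilon>" using abs_diff_le_l1_dist[OF i, of m y] z by (simp add: z_def)
    then show "\<bar>v i\<bar> \<le> ?C" using \<epsilon>_pos by (simp add: v_def field_simps)
  next
    have Vy: "V m - l * (?C * \<epsilon>) \<le> V y"
      using V_lip[OF m y] mult_left_mono[OF z l_nonneg] by (simp add: z_def)
    show "V m \<le> envelope m + l * ?C * \<epsilon> + \<eta>"
    proof -
      have "0 \<le> sq_dist d m y / (2 * \<epsilon>)" using \<epsilon>_pos by simp
      then show ?thesis using Vy near by (simp add: mult.assoc)
    qed
    have v: "\<bar>v i\<bar> \<le> ?C" if "i < d" for i
      using abs_diff_le_l1_dist[OF that, of m y] z \<epsilon>_pos by (simp add: z_def v_def field_simps)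
    have "(\<Sum>i<d. (drift y i)\<^sup>2) \<le> (\<Sum>i<d. rate_bound * \<bar>drift y i\<bar>)"
    proof (rule sum_mono)
      fix i assume "i \<in> {..<d}"
      then have "\<bar>drift y i\<bar> \<le> rate_bound"
        using abs_diff_le_l1_dist[of i d "drift y" "\<lambda>_. 0"] drift_bounded[OF y] by simp
      then have "\<bar>drift y i\<bar> * \<bar>drift y i\<bar> \<le> rate_bound * \<bar>drift y i\<bar>" by (intro mult_right_mono) auto
      then show "(drift y i)\<^sup>2 \<le> rate_bound * \<bar>drift y i\<bar>" by (simp add: power2_eq_square)
    qed
    also have "\<dots> \<le> rate_bound * rate_bound"
      using drift_bounded[OF y] rate_bound_pos
      by (simp add: l1_dist_def mult_left_mono flip: sum_distrib_left)
    finally have speed: "(\<Sum>i<d. (drift y i)\<^sup>2) \<le> rate_bound\<^sup>2" by (simp add: power2_eq_square)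
    let ?S = "\<Sum>i<d. (m i - y i) * drift y i"
    have S: "?S / \<epsilon> = (\<Sum>i<d. v i * drift y i)"
      by (simp add: v_def sum_divide_distrib)
    \<comment> \<open>Near-minimality of \<open>y\<close> against its own Euler step. Expanding the
      square isolates the pairing of \<open>v\<close> with the drift at \<open>y\<close>, while
      \<open>V_step\<close> bounds the change of \<open>V\<close>.\<close>
    have "V y + sq_dist d m y / (2 * \<epsilon>) \<le> V (euler_step drift h y) + sq_dist d m (euler_step drift h y) / (2 * \<epsilon>) + \<eta>"
      using near envelope_le[OF drift_step_in[OF y _ h_le], of m] h_pos by linarith
    also have "sq_dist d m (euler_step drift h y)
        = sq_dist d m y - 2 * h * ?S + h\<^sup>2 * (\<Sum>i<d. (drift y i)\<^sup>2)"
      by (rule sq_dist_euler_step)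
    also have "\<dots> \<le> sq_dist d m y - 2 * h * ?S + h\<^sup>2 * rate_bound\<^sup>2"
      using speed by (intro add_left_mono mult_left_mono) auto
    finally have "V y + sq_dist d m y / (2 * \<epsilon>)
        \<le> V (euler_step drift h y) + (sq_dist d m y - 2 * h * ?S + h\<^sup>2 * rate_bound\<^sup>2) / (2 * \<epsilon>) + \<eta>"
      using \<epsilon>_pos by (simp add: divide_right_mono)
    also have "(sq_dist d m y - 2 * h * ?S + h\<^sup>2 * rate_bound\<^sup>2) / (2 * \<epsilon>)
        = sq_dist d m y / (2 * \<epsilon>) - h * (?S / \<epsilon>) + h * (h * rate_bound\<^sup>2 / (2 * \<epsilon>))"
      by (simp add: add_divide_distrib diff_divide_distrib power2_eq_square)
    finally have "h * (?S / \<epsilon>) \<le> h * (- \<kappa> * V y + h * rate_bound\<^sup>2 / (2 * \<epsilon>) + \<eta> / h)"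
      using V_step[OF y] h_pos by (simp add: algebra_simps)
    then have at_y: "(\<Sum>i<d. v i * drift y i) \<le> - \<kappa> * V y + h * rate_bound\<^sup>2 / (2 * \<epsilon>) + \<eta> / h"
      using h_pos unfolding S by (simp only: mult_le_cancel_left_pos)
    \<comment> \<open>Back from \<open>y\<close> to \<open>m\<close>: the drift is Lipschitz and the
      distance is at most \<open>slope_bound * \<epsilon>\<close>.\<close>
    have "(\<Sum>i<d. v i * drift m i) - (\<Sum>i<d. v i * drift y i) = (\<Sum>i<d. v i * (drift m i - drift y i))"
      by (simp add: right_diff_distrib sum_subtractf)
    also have "\<dots> \<le> (\<Sum>i<d. ?C * \<bar>drift m i - drift y i\<bar>)"
    proof (rule sum_mono)
      fix i assume "i \<in> {..<d}"
      then have "\<bar>v i\<bar> * \<bar>drift m i - drift y i\<bar> \<le> ?C * \<bar>drift m i - drift y i\<bar>"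
        using v by (intro mult_right_mono) auto
      then show "v i * (drift m i - drift y i) \<le> ?C * \<bar>drift m i - drift y i\<bar>"
        using abs_ge_self[of "v i * (drift m i - drift y i)"] by (simp add: abs_mult)
    qed
    also have "\<dots> = ?C * l1_dist d (drift m) (drift y)" by (simp add: l1_dist_def sum_distrib_left)
    also have "\<dots> \<le> ?C * (3 * rate_bound * z)"
      using drift_lipschitz[of m y] C by (intro mult_left_mono) (auto simp: z_def)
    also have "\<dots> \<le> ?C * (3 * rate_bound * (?C * \<epsilon>))"
      using z C rate_bound_pos by (intro mult_left_mono) auto
    finally have "(\<Sum>i<d. v i * drift m i) \<le> (\<Sum>i<d. v i * drift y i) + 3 * rate_bound * ?C\<^sup>2 * \<epsilon>"
      by (simp add: power2_eq_square mult_ac)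
    moreover have "\<kappa> * (V m - l * (?C * \<epsilon>)) \<le> \<kappa> * V y" using Vy \<kappa>_pos by (intro mult_left_mono) auto
    ultimately show "(\<Sum>j<d. v j * drift m j)
        \<le> - \<kappa> * V m + (\<kappa> * l * ?C + 3 * rate_bound * ?C\<^sup>2) * \<epsilon> + h * rate_bound\<^sup>2 / (2 * \<epsilon>) + \<eta> / h"
      using at_y by (simp add: algebra_simps)
  qed
qed

end

context euler_lyapunov
begin

text \<open>Bounds the estimate \<open>D i j\<close> below of \<open>N\<close> times the change of
  the envelope in one jump: two slopes, plus quadratic remainder and slack at their values for
  \<open>N = 1\<close>.\<close>

definition jump_bound :: real where
  "jump_bound = 2 * slope_bound + 1 / \<epsilon> + 1"

text \<open>A jump changes the exponent by order \<theta>, whatever \<open>N\<close> is. To first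
  order in \<theta> the generator pairs the slope with the drift; the quadratic term of the
  exponential costs \<open>\<theta> * jump_bound^2 * rate_bound\<close>.\<close>

lemma envelope_generator_le:
  assumes m: "m \<in> bsimplex d" and N: "1 \<le> N" "1 / (real N)\<^sup>2 \<le> \<epsilon>"
    and \<theta>: "0 < \<theta>" "\<theta> * jump_bound \<le> 1"
  defines "f \<equiv> \<lambda>m. exp (\<theta> * real N * envelope m)"
  shows "(\<Sum>i<d. \<Sum>j\<in>{..<d} - {i}. flux m i j * (f (m(i := m i - 1 / real N, j := m j + 1 / real N)) - f m))
    \<le> f m * \<theta> * (- \<kappa> * V m + (\<kappa> * l * slope_bound + 3 * rate_bound * slope_bound\<^sup>2) * \<epsilon>
        + h * rate_bound\<^sup>2 / (2 * \<epsilon>) + 1 / (real N)\<^sup>2 / h + (1 / \<epsilon> + 1) * rate_bound / real N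
        + \<theta> * jump_bound\<^sup>2 * rate_bound)"
proof -
  have N0: "0 < real N" "1 \<le> real N" using N by auto
  \<comment> \<open>The slack is \<open>1 / N^2\<close> because the exponent multiplies it by
    \<open>N\<close>.\<close>
  obtain v where
    v1: "\<And>i j \<delta>. i < d \<Longrightarrow> j < d \<Longrightarrow> i \<noteq> j \<Longrightarrow>
      envelope (m(i := m i - \<delta>, j := m j + \<delta>)) \<le> envelope m + \<delta> * (v j - v i) + \<delta>\<^sup>2 / \<epsilon> + 1 / (real N)\<^sup>2"
    and v2: "\<And>i. i < d \<Longrightarrow> \<bar>v i\<bar> \<le> slope_bound"
    and v3: "(\<Sum>j<d. v j * drift m j) \<le> - \<kappa> * V m + (\<kappa> * l * slope_bound + 3 * rate_bound * slope_bound\<^sup>2) * \<epsilon>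
      + h * rate_bound\<^sup>2 / (2 * \<epsilon>) + 1 / (real N)\<^sup>2 / h"
    by (rule envelope_slope[OF m _ N(2)]) (use N0 in auto)
  define r where "r = (1 / \<epsilon> + 1) / real N"
  define D where "D i j = v j - v i + r" for i j
  have r: "0 \<le> r" "r \<le> 1 / \<epsilon> + 1"
    using N0 \<epsilon>_pos divide_left_mono[of 1 "real N" "1 / \<epsilon> + 1"] by (auto simp: r_def)
  have jump: "f (m(i := m i - 1 / real N, j := m j + 1 / real N)) - f m
      \<le> f m * \<theta> * (D i j + \<theta> * jump_bound\<^sup>2)" if ij: "i < d" "j < d" "i \<noteq> j" for i j
  proof -
    let ?m' = "m(i := m i - 1 / real N, j := m j + 1 / real N)"
    have "real N * envelope ?m' \<le> real N * (envelope m + 1 / real N * (v j - v i) + (1 / real N)\<^sup>2 / \<epsilon> + 1 / (real N)\<^sup>2)"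
      using v1[OF ij, of "1 / real N"] N0 by (intro mult_left_mono) auto
    also have "\<dots> = real N * envelope m + D i j"
      using N0 \<epsilon>_pos by (simp add: D_def r_def field_simps power2_eq_square)
    finally have "\<theta> * (real N * envelope ?m') \<le> \<theta> * (real N * envelope m + D i j)"
      using \<theta> by (intro mult_left_mono) auto
    then have "f ?m' \<le> exp (\<theta> * real N * envelope m + \<theta> * D i j)"
      by (simp add: f_def algebra_simps)
    also have "\<dots> = f m * exp (\<theta> * D i j)" by (simp add: f_def exp_add)
    also have "\<dots> \<le> f m * (1 + \<theta> * D i j + (\<theta> * jump_bound)\<^sup>2)"
    proof (rule mult_left_mono)
      have "\<bar>D i j\<bar> \<le> jump_bound"
        using v2[OF ij(1)] v2[OF ij(2)] r unfolding D_def jump_bound_def by linarith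
      then have "\<theta> * \<bar>D i j\<bar> \<le> \<theta> * jump_bound" using \<theta> by (intro mult_left_mono) auto
      then have D: "\<bar>\<theta> * D i j\<bar> \<le> \<theta> * jump_bound" using \<theta> by (simp add: abs_mult)
      then have "(\<theta> * D i j)\<^sup>2 \<le> (\<theta> * jump_bound)\<^sup>2" using power_mono[OF D, of 2] by simp
      then show "exp (\<theta> * D i j) \<le> 1 + \<theta> * D i j + (\<theta> * jump_bound)\<^sup>2"
        using exp_le_quadratic[of "\<theta> * D i j"] D \<theta> by linarith
    qed (simp add: f_def)
    finally show ?thesis by (simp add: algebra_simps power2_eq_square)
  qed
  have "(\<Sum>i<d. \<Sum>j\<in>{..<d} - {i}. flux m i j * (f (m(i := m i - 1 / real N, j := m j + 1 / real N)) - f m))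
      \<le> (\<Sum>i<d. \<Sum>j\<in>{..<d} - {i}. flux m i j * (f m * \<theta> * (D i j + \<theta> * jump_bound\<^sup>2)))"
    using flux_nonneg[OF m] by (intro sum_mono mult_left_mono jump) auto
  also have "\<dots> = f m * \<theta> * ((\<Sum>i<d. \<Sum>j\<in>{..<d} - {i}. flux m i j * (v j - v i))
      + (r + \<theta> * jump_bound\<^sup>2) * (\<Sum>i<d. \<Sum>j\<in>{..<d} - {i}. flux m i j))"
  proof -
    have "flux m i j * (f m * \<theta> * (D i j + \<theta> * jump_bound\<^sup>2))
        = f m * \<theta> * (flux m i j * (v j - v i)) + f m * \<theta> * ((r + \<theta> * jump_bound\<^sup>2) * flux m i j)" for i j
      unfolding D_def by algebra
    then show ?thesis by (simp only: sum.distrib sum_distrib_left distrib_left)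
  qed
  also have "\<dots> \<le> f m * \<theta> * ((\<Sum>j<d. v j * drift m j) + (r + \<theta> * jump_bound\<^sup>2) * rate_bound)"
    unfolding flux_pairing using flux_total[OF m] r \<theta>
    by (intro mult_left_mono add_left_mono) (auto simp: f_def)
  also have "\<dots> \<le> f m * \<theta> * (- \<kappa> * V m + (\<kappa> * l * slope_bound + 3 * rate_bound * slope_bound\<^sup>2) * \<epsilon>
        + h * rate_bound\<^sup>2 / (2 * \<epsilon>) + 1 / (real N)\<^sup>2 / h + (1 / \<epsilon> + 1) * rate_bound / real N
        + \<theta> * jump_bound\<^sup>2 * rate_bound)"
  proof (rule mult_left_mono)
    have "(r + \<theta> * jump_bound\<^sup>2) * rate_bound = (1 / \<epsilon> + 1) * rate_bound / real N + \<theta> * jump_bound\<^sup>2 * rate_bound"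
      by (simp add: r_def algebra_simps add_divide_distrib)
    then show "(\<Sum>j<d. v j * drift m j) + (r + \<theta> * jump_bound\<^sup>2) * rate_bound
      \<le> - \<kappa> * V m + (\<kappa> * l * slope_bound + 3 * rate_bound * slope_bound\<^sup>2) * \<epsilon>
        + h * rate_bound\<^sup>2 / (2 * \<epsilon>) + 1 / (real N)\<^sup>2 / h + (1 / \<epsilon> + 1) * rate_bound / real N
        + \<theta> * jump_bound\<^sup>2 * rate_bound"
      using v3 by linarith
  qed (use \<theta> in \<open>simp add: f_def\<close>)
  finally show ?thesis .
qed

text \<open>Integrating the generator of \<open>exp (\<theta> N envelope)\<close> against the stationary law gives 0, which
  balances its decrease where \<open>V\<close> is large against its bounded increase where \<open>V\<close> is small.\<close>
lemma stationary_tail: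
  assumes N: "1 \<le> N" "1 / (real N)\<^sup>2 \<le> \<epsilon>" and K: "\<alpha> * real N = real K"
    and st: "wip_stationary d Q0 Q1 N K p"
    and \<theta>: "0 < \<theta>" "\<theta> * jump_bound \<le> 1"
    and errors: "(\<kappa> * l * slope_bound + 3 * rate_bound * slope_bound\<^sup>2) * \<epsilon>
        + h * rate_bound\<^sup>2 / (2 * \<epsilon>) + 1 / (real N)\<^sup>2 / h + (1 / \<epsilon> + 1) * rate_bound / real N
        + \<theta> * jump_bound\<^sup>2 * rate_bound \<le> \<kappa> * u / 2"
    and gap: "l * slope_bound * \<epsilon> + 1 / (real N)\<^sup>2 \<le> u"
  shows "(\<Sum>x | x \<in> configs d N \<and> 3 * u \<le> V (fractions N x). p x) \<le> exp (- \<theta> * u * real N)"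
proof -
  let ?C = "configs d N"
  define f where "f = (\<lambda>m. exp (\<theta> * real N * envelope m))"
  define c where "c = \<theta> * (\<kappa> * u / 2)"
  have fin: "finite ?C" using st by (rule wip_stationary_finite)
  have p: "\<And>x. x \<in> ?C \<Longrightarrow> 0 \<le> p x" "(\<Sum>x\<in>?C. p x) = 1"
    using st by (auto simp: wip_stationary_def)
  have C: "0 \<le> slope_bound" using l_nonneg by (simp add: slope_bound_def)
  have u: "0 < u"
  proof -
    have "0 < 1 / (real N)\<^sup>2" using N by simp
    moreover have "0 \<le> l * slope_bound * \<epsilon>" using l_nonneg C \<epsilon>_pos by simp
    ultimately show ?thesis using gap by linarith
  qed
  have c: "0 < c" using \<theta> u \<kappa>_pos by (simp add: c_def)
  define J where "J m = (\<Sum>i<d. \<Sum>j\<in>{..<d} - {i}.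
      flux m i j * (f (m(i := m i - 1 / real N, j := m j + 1 / real N)) - f m))" for m
  define hi where "hi = {x \<in> ?C. u \<le> V (fractions N x)}"
  define lo where "lo = {x \<in> ?C. V (fractions N x) < u}"
  have J: "J m \<le> f m * \<theta> * (- \<kappa> * V m + \<kappa> * u / 2)" if m: "m \<in> bsimplex d" for m
  proof -
    have "J m \<le> f m * \<theta> * (- \<kappa> * V m + (\<kappa> * l * slope_bound + 3 * rate_bound * slope_bound\<^sup>2) * \<epsilon>
        + h * rate_bound\<^sup>2 / (2 * \<epsilon>) + 1 / (real N)\<^sup>2 / h + (1 / \<epsilon> + 1) * rate_bound / real N
        + \<theta> * jump_bound\<^sup>2 * rate_bound)"
      unfolding J_def f_def by (rule envelope_generator_le[OF m N \<theta>])
    also have "\<dots> \<le> f m * \<theta> * (- \<kappa> * V m + \<kappa> * u / 2)"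
      using errors \<theta> by (intro mult_left_mono) (auto simp: f_def)
    finally show ?thesis .
  qed
  have J_hi: "p x * J (fractions N x) \<le> - c * (p x * f (fractions N x))" if x: "x \<in> hi" for x
  proof -
    let ?m = "fractions N x"
    have m: "?m \<in> bsimplex d" using x N fractions_in_bsimplex by (auto simp: hi_def)
    have "\<kappa> * u \<le> \<kappa> * V ?m" using x \<kappa>_pos by (intro mult_left_mono) (auto simp: hi_def)
    then have "f ?m * \<theta> * (- \<kappa> * V ?m + \<kappa> * u / 2) \<le> f ?m * \<theta> * (- (\<kappa> * u / 2))"
      using \<theta> by (intro mult_left_mono) (auto simp: f_def)
    then have "J ?m \<le> - c * f ?m" using J[OF m] by (simp add: c_def mult_ac)
    then have "p x * J ?m \<le> p x * (- c * f ?m)" using p(1) x by (intro mult_left_mono) (auto simp: hi_def)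
    then show ?thesis by (simp add: mult_ac)
  qed
  have J_lo: "p x * J (fractions N x) \<le> c * exp (\<theta> * u * real N) * p x" if x: "x \<in> lo" for x
  proof -
    let ?m = "fractions N x"
    have m: "?m \<in> bsimplex d" using x N fractions_in_bsimplex by (auto simp: lo_def)
    have "f ?m * \<theta> * (- \<kappa> * V ?m + \<kappa> * u / 2) \<le> f ?m * \<theta> * (\<kappa> * u / 2)"
      using V_nonneg[OF m] \<kappa>_pos \<theta> by (intro mult_left_mono) (auto simp: f_def)
    also have "\<dots> = c * f ?m" by (simp add: c_def)
    also have "\<dots> \<le> c * exp (\<theta> * u * real N)"
    proof (rule mult_left_mono)
      have "envelope ?m \<le> u" using envelope_le_self[OF m] x by (auto simp: lo_def)
      then have "\<theta> * real N * envelope ?m \<le> \<theta> * real N * u" using \<theta> by (intro mult_left_mono) auto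
      then show "f ?m \<le> exp (\<theta> * u * real N)" by (simp add: f_def mult_ac)
    qed (use c in simp)
    finally have "J ?m \<le> c * exp (\<theta> * u * real N)" using J[OF m] by linarith
    then have "p x * J ?m \<le> p x * (c * exp (\<theta> * u * real N))"
      using p(1) x by (intro mult_left_mono) (auto simp: lo_def)
    then show ?thesis by (simp add: mult_ac)
  qed
  have "0 = (\<Sum>x\<in>?C. p x * J (fractions N x))"
    using stationary_balance[OF N(1) K st, of f] by (simp add: J_def Let_def)
  also have "\<dots> = (\<Sum>x\<in>hi. p x * J (fractions N x)) + (\<Sum>x\<in>lo. p x * J (fractions N x))"
  proof -
    have "?C = hi \<union> lo" by (auto simp: hi_def lo_def)
    moreover have "finite hi" "finite lo" "hi \<inter> lo = {}" using fin by (auto simp: hi_def lo_def)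
    ultimately show ?thesis by (simp only: sum.union_disjoint)
  qed
  also have "\<dots> \<le> (\<Sum>x\<in>hi. - c * (p x * f (fractions N x))) + (\<Sum>x\<in>lo. c * exp (\<theta> * u * real N) * p x)"
    by (intro add_mono sum_mono J_hi J_lo)
  also have "\<dots> = c * (exp (\<theta> * u * real N) * (\<Sum>x\<in>lo. p x) - (\<Sum>x\<in>hi. p x * f (fractions N x)))"
    by (simp only: sum_distrib_left[symmetric]) (simp add: algebra_simps)
  finally have "(\<Sum>x\<in>hi. p x * f (fractions N x)) \<le> exp (\<theta> * u * real N) * (\<Sum>x\<in>lo. p x)"
    using c by (simp add: zero_le_mult_iff)
  also have "\<dots> \<le> exp (\<theta> * u * real N) * 1"
  proof (rule mult_left_mono)
    have "(\<Sum>x\<in>lo. p x) \<le> (\<Sum>x\<in>?C. p x)" using fin p(1) by (intro sum_mono2) (auto simp: lo_def)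
    then show "(\<Sum>x\<in>lo. p x) \<le> 1" using p(2) by simp
  qed simp
  finally have hi: "(\<Sum>x\<in>hi. p x * f (fractions N x)) \<le> exp (\<theta> * u * real N)" by simp
  \<comment> \<open>Here the envelope is at least \<open>2 * u\<close>, so each weight is at least
    \<open>exp (2 * (\<theta> * u * N))\<close>, while the weighted mass of \<open>hi\<close> is at
    most \<open>exp (\<theta> * u * N)\<close>. The quotient is the claimed tail.\<close>
  define far where "far = {x. x \<in> ?C \<and> 3 * u \<le> V (fractions N x)}"
  have "(\<Sum>x\<in>far. p x) * exp (2 * (\<theta> * u * real N)) \<le> (\<Sum>x\<in>far. p x * f (fractions N x))"
    unfolding sum_distrib_right
  proof (intro sum_mono mult_left_mono)
    fix x assume x: "x \<in> far"
    let ?m = "fractions N x"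
    have m: "?m \<in> bsimplex d" using x N fractions_in_bsimplex by (auto simp: far_def)
    have "0 < 1 / (real N)\<^sup>2" using N by simp
    from envelope_slope[OF m this N(2)] have "V ?m \<le> envelope ?m + l * slope_bound * \<epsilon> + 1 / (real N)\<^sup>2"
      by blast
    then have "2 * u \<le> envelope ?m" using x gap by (auto simp: far_def)
    then have "\<theta> * real N * (2 * u) \<le> \<theta> * real N * envelope ?m" using \<theta> by (intro mult_left_mono) auto
    then show "exp (2 * (\<theta> * u * real N)) \<le> f ?m" by (simp add: f_def mult_ac)
    show "0 \<le> p x" using p(1) x by (auto simp: far_def)
  qed
  also have "\<dots> \<le> (\<Sum>x\<in>hi. p x * f (fractions N x))"
    using fin p(1) u by (intro sum_mono2) (auto simp: far_def hi_def f_def)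
  also note hi
  finally have "(\<Sum>x\<in>far. p x) * exp (2 * (\<theta> * u * real N)) \<le> exp (\<theta> * u * real N)" .
  then have "(\<Sum>x\<in>far. p x) \<le> exp (\<theta> * u * real N) / exp (2 * (\<theta> * u * real N))"
    by (simp add: pos_le_divide_eq)
  also have "\<dots> = exp (- \<theta> * u * real N)"
    by (simp add: exp_diff[symmetric])
  finally show ?thesis by (simp add: far_def)
qed

end

context wip_bandit
begin

section \<open>A Lyapunov function from the attraction of the Euler scheme\<close>

definition excess :: "(nat \<Rightarrow> real) \<Rightarrow> real \<Rightarrow> (nat \<Rightarrow> real) \<Rightarrow> real" where
  "excess ms r m = max 0 (l1_dist d m ms - r)"

text \<open>The weights \<open>w ^ k\<close> turn the eventual arrival of the Euler scheme in the ball of radius \<open>r\<close>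
  into a geometric decrease at every single step.\<close>
definition max_excess :: "(nat \<Rightarrow> real) \<Rightarrow> real \<Rightarrow> real \<Rightarrow> real \<Rightarrow> nat \<Rightarrow> (nat \<Rightarrow> real) \<Rightarrow> real" where
  "max_excess ms r w h n m = Max ((\<lambda>k. w ^ k * excess ms r (iter h k m)) ` {..n})"

lemma max_excess_ge: "k \<le> n \<Longrightarrow> w ^ k * excess ms r (iter h k m) \<le> max_excess ms r w h n m"
  unfolding max_excess_def by (intro Max_ge) auto

lemma max_excess_le:
  assumes "\<And>k. k \<le> n \<Longrightarrow> w ^ k * excess ms r (iter h k m) \<le> c"
  shows "max_excess ms r w h n m \<le> c"
  unfolding max_excess_def using assms by (subst Max_le_iff) auto

lemma excess_le_max_excess: "excess ms r m \<le> max_excess ms r w h n m"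
  using max_excess_ge[of 0 n w ms r h m] by simp

lemma max_excess_nonneg: "0 \<le> max_excess ms r w h n m"
  using excess_le_max_excess[of ms r m w h n] by (simp add: excess_def)

text \<open>Starting one step later shifts the index by one, and \<open>w\<close> supplies the
  missing power. The only term without a counterpart, \<open>k = n\<close>, vanishes because the
  scheme is in the ball by then.\<close>

lemma max_excess_step:
  assumes m: "m \<in> bsimplex d" and w: "0 \<le> w"
    and reach: "l1_dist d (iter h n (euler_step drift h m)) ms \<le> r"
  shows "w * max_excess ms r w h n (euler_step drift h m) \<le> max_excess ms r w h n m"
proof (cases "w = 0")
  case True
  then show ?thesis using max_excess_nonneg by simp
next
  case False
  have "w ^ k * excess ms r (iter h k (euler_step drift h m)) \<le> max_excess ms r w h n m / w"
    if "k \<le> n" for k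
  proof (cases "k = n")
    case True
    then show ?thesis using reach max_excess_nonneg[of ms r w h n m] w by (simp add: excess_def)
  next
    case neq: False
    have "w ^ Suc k * excess ms r (iter h (Suc k) m) \<le> max_excess ms r w h n m"
      using neq that by (intro max_excess_ge) auto
    then show ?thesis using False w by (simp add: funpow_swap1 field_simps)
  qed
  then have "max_excess ms r w h n (euler_step drift h m) \<le> max_excess ms r w h n m / w"
    by (rule max_excess_le)
  then show ?thesis using False w by (simp add: field_simps)
qed

text \<open>The constant involves only \<open>w ^ n\<close> and the time \<open>n * h\<close>. For
  the weight used later both stay bounded as the mesh shrinks, so a Lipschitz constant can be fixed
  before \<open>h\<close>.\<close>

lemma max_excess_lipschitz:
  assumes x: "x \<in> bsimplex d" and y: "y \<in> bsimplex d" and w: "1 \<le> w" and h: "0 \<le> h" "h \<le> 1 / rate_bound"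
  shows "max_excess ms r w h n x
    \<le> max_excess ms r w h n y + w ^ n * exp (3 * rate_bound * (real n * h)) * l1_dist d x y"
proof (rule max_excess_le)
  fix k assume k: "k \<le> n"
  have "excess ms r (iter h k x) \<le> excess ms r (iter h k y) + l1_dist d (iter h k x) (iter h k y)"
    using l1_dist_triangle[of d "iter h k x" ms "iter h k y"] l1_dist_nonneg[of d "iter h k x" "iter h k y"]
    unfolding excess_def by linarith
  then have "w ^ k * excess ms r (iter h k x) \<le> w ^ k * (excess ms r (iter h k y) + l1_dist d (iter h k x) (iter h k y))"
    using w by (intro mult_left_mono) auto
  also have "\<dots> = w ^ k * excess ms r (iter h k y) + w ^ k * l1_dist d (iter h k x) (iter h k y)"
    by (rule distrib_left)
  also have "w ^ k * excess ms r (iter h k y) \<le> max_excess ms r w h n y"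
    using k by (rule max_excess_ge)
  also have "w ^ k * l1_dist d (iter h k x) (iter h k y)
      \<le> w ^ n * (exp (3 * rate_bound * (real n * h)) * l1_dist d x y)"
  proof (rule mult_mono)
    show "w ^ k \<le> w ^ n" using w k by (rule power_increasing[rotated])
    have "exp (3 * rate_bound * (real k * h)) \<le> exp (3 * rate_bound * (real n * h))"
      using k h rate_bound_pos by (simp add: mult_mono)
    then show "l1_dist d (iter h k x) (iter h k y) \<le> exp (3 * rate_bound * (real n * h)) * l1_dist d x y"
      using iter_lip[OF x y h, of k] mult_right_mono[OF _ l1_dist_nonneg[of d x y]] by (meson order_trans)
  qed (use w in auto)
  finally show "w ^ k * excess ms r (iter h k x)
      \<le> max_excess ms r w h n y + w ^ n * exp (3 * rate_bound * (real n * h)) * l1_dist d x y"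
    by (simp add: mult.assoc)
qed

lemma stationary_concentration:
  assumes attr: "uniform_global_attractor d Q0 Q1 \<alpha> mstar" and R: "0 < R"
  obtains b c where "0 < b" "0 < c"
    and "\<And>N K p. 1 \<le> N \<Longrightarrow> \<alpha> * real N = real K \<Longrightarrow> wip_stationary d Q0 Q1 N K p \<Longrightarrow>
      (\<Sum>x | x \<in> configs d N \<and> R < l1_dist d (fractions N x) mstar. p x) \<le> b * exp (- c * real N)"
proof -
  let ?\<Lambda> = rate_bound
  note \<Lambda> = rate_bound_pos
  obtain T K where T: "0 < T"
    and reach: "\<And>k m. K \<le> k \<Longrightarrow> m \<in> bsimplex d \<Longrightarrow> l1_dist d (iter ((1/2) ^ k) (T * 2 ^ k) m) mstar \<le> R / 2"
    using euler_attraction[OF attr, of "R / 2"] R by auto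
  define \<kappa> where "\<kappa> = 1 / (2 * real T)"
  define l where "l = exp 1 * exp (3 * ?\<Lambda> * real T)"
  \<comment> \<open>A distance above \<open>R\<close> exceeds the radius \<open>R / 2\<close> by
    more than \<open>3 * u\<close>, the level in \<open>stationary_tail\<close>.\<close>
  define u where "u = R / 6"
  \<comment> \<open>The value of \<open>slope_bound\<close>, written out because \<epsilon> depends
    on it and must be known before the locale is interpreted.\<close>
  define C where "C = 2 * real d * (l + 1)"
  define A where "A = \<kappa> * l * C + 3 * ?\<Lambda> * C\<^sup>2"
  \<comment> \<open>The error budget \<open>\<kappa> * u / 2\<close> is split into four parts
    \<open>\<kappa> * u / 8\<close>, met through \<epsilon>, \<open>hmax\<close>, \<theta> and
    \<delta>. The second argument of \<open>min\<close> secures half of the gap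
    \<open>u\<close>.\<close>
  define \<epsilon> where "\<epsilon> = min (\<kappa> * u / (8 * (A + 1))) (u / (2 * (l * C + 1)))"
  have pos: "0 < \<kappa>" "0 < l" "0 < u" using T R by (auto simp: \<kappa>_def l_def u_def)
  then have C: "0 \<le> C" by (simp add: C_def)
  then have A: "0 \<le> A" "0 \<le> l * C" using pos \<Lambda> by (auto simp: A_def)
  have \<epsilon>: "0 < \<epsilon>" using pos A by (auto simp: \<epsilon>_def)
  have cancel: "a * (x / (k * a)) = x / k" if "0 < a" for a x k :: real
    using that by simp
  have \<epsilon>A: "A * \<epsilon> \<le> \<kappa> * u / 8"
  proof -
    have "A * \<epsilon> \<le> (A + 1) * (\<kappa> * u / (8 * (A + 1)))"
      using A \<epsilon> by (intro mult_mono) (auto simp: \<epsilon>_def)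
    also have "\<dots> = \<kappa> * u / 8"
      using A by (intro cancel) auto
    finally show ?thesis .
  qed
  have \<epsilon>C: "l * C * \<epsilon> \<le> u / 2"
  proof -
    have "l * C * \<epsilon> \<le> (l * C + 1) * (u / (2 * (l * C + 1)))"
      using A \<epsilon> by (intro mult_mono) (auto simp: \<epsilon>_def)
    also have "\<dots> = u / 2" using A by (intro cancel) auto
    finally show ?thesis .
  qed
  define hmax where "hmax = \<kappa> * u * \<epsilon> / (4 * ?\<Lambda>\<^sup>2)"
  have "0 < hmax" using pos \<epsilon> \<Lambda> by (simp add: hmax_def)
  then obtain k1 where k1: "\<And>k. k1 \<le> k \<Longrightarrow> (1/2::real) ^ k \<le> hmax" using mesh_small by blast
  define k where "k = max K (max min_level k1)"
  define h :: real where "h = (1/2) ^ k"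
  define n where "n = T * 2 ^ k"
  \<comment> \<open>The \<open>n\<close> steps last the time \<open>T\<close>, so
    \<open>w ^ n\<close> stays below \<open>exp 1\<close> for every mesh.\<close>
  define w where "w = 1 + h / real T"
  have h: "0 < h" "h \<le> 1 / ?\<Lambda>" "h \<le> hmax" "h \<le> 1"
    using mesh_le_h0[of k] k1[of k] by (auto simp: h_def k_def power_le_one)
  have nh: "real n * h = real T" by (simp add: n_def h_def power_one_over)
  have hT: "h * ?\<Lambda>\<^sup>2 / (2 * \<epsilon>) \<le> \<kappa> * u / 8"
  proof -
    have "h * ?\<Lambda>\<^sup>2 / (2 * \<epsilon>) \<le> hmax * ?\<Lambda>\<^sup>2 / (2 * \<epsilon>)"
      using h \<epsilon> by (intro divide_right_mono mult_right_mono) auto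
    also have "\<dots> = \<kappa> * u / 8" using \<Lambda> \<epsilon> by (simp add: hmax_def field_simps)
    finally show ?thesis .
  qed
  have w: "1 \<le> w" "w \<le> 2" using h T by (auto simp: w_def divide_le_eq)
  have wn: "w ^ n \<le> exp 1"
  proof -
    have "w ^ n \<le> exp (h / real T) ^ n" using w by (intro power_mono) (auto simp: w_def)
    also have "\<dots> = exp (real n * h / real T)" by (simp add: exp_of_nat_mult[symmetric])
    also have "\<dots> = exp 1" using nh T by simp
    finally show ?thesis .
  qed
  define V where "V = max_excess mstar (R / 2) w h n"
  have V_step: "V (euler_step drift h y) \<le> V y - h * \<kappa> * V y" if y: "y \<in> bsimplex d" for y
  proof -
    have "l1_dist d (iter h n (euler_step drift h y)) mstar \<le> R / 2"
      unfolding h_def n_def using h y by (intro reach) (auto simp: k_def h_def intro!: drift_step_in)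
    then have "w * V (euler_step drift h y) \<le> V y"
      unfolding V_def using y w by (intro max_excess_step) auto
    then have "V (euler_step drift h y) \<le> V y / w" using w by (simp add: field_simps)
    moreover have "V y / w \<le> V y * (1 - h * \<kappa>)"
    proof -
      \<comment> \<open>On the interval from 1 to 2, \<open>1 / w\<close> is at most
        \<open>1 - (w - 1) / 2\<close>; hence the 2 in \<kappa>.\<close>
      have "1 / w \<le> 1 - h * \<kappa>"
      proof -
        have hk: "h * \<kappa> = (w - 1) / 2" by (simp add: \<kappa>_def w_def)
        have "0 \<le> (w - 1) * (2 - w)" using w by simp
        then have "2 \<le> w * (3 - w)" by (simp add: algebra_simps)
        then show ?thesis unfolding hk using w by (simp add: field_simps)
      qed
      then have "V y * (1 / w) \<le> V y * (1 - h * \<kappa>)"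
        using max_excess_nonneg by (intro mult_left_mono) (auto simp: V_def)
      then show ?thesis by simp
    qed
    ultimately show ?thesis by (simp add: algebra_simps)
  qed
  interpret E: euler_lyapunov d Q0 Q1 \<alpha> V l \<kappa> h \<epsilon>
  proof
    show "0 \<le> V m" for m by (simp add: V_def max_excess_nonneg)
    show "V x \<le> V y + l * l1_dist d x y" if "x \<in> bsimplex d" "y \<in> bsimplex d" for x y
    proof -
      have "w ^ n * exp (3 * ?\<Lambda> * (real n * h)) * l1_dist d x y \<le> l * l1_dist d x y"
        unfolding nh l_def using wn by (intro mult_right_mono) auto
      then show ?thesis
        using max_excess_lipschitz[OF that w(1), of h mstar "R / 2" n] h unfolding V_def by linarith
    qed
  qed (use V_step pos h \<epsilon> in auto)
  have slope: "E.slope_bound = C" by (simp add: E.slope_bound_def C_def)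
  define D where "D = E.jump_bound"
  have D: "0 < D" using \<epsilon> C by (simp add: D_def E.jump_bound_def slope add_nonneg_pos)
  define \<theta> where "\<theta> = min (1 / D) (\<kappa> * u / (8 * (D\<^sup>2 * ?\<Lambda>)))"
  have \<theta>: "0 < \<theta>" "\<theta> * D \<le> 1" "\<theta> * D\<^sup>2 * ?\<Lambda> \<le> \<kappa> * u / 8"
  proof -
    show "0 < \<theta>" using D pos \<Lambda> by (simp add: \<theta>_def)
    have "\<theta> * D \<le> 1 / D * D" using D by (intro mult_right_mono) (auto simp: \<theta>_def)
    then show "\<theta> * D \<le> 1" using D by simp
    have "\<theta> * (D\<^sup>2 * ?\<Lambda>) \<le> \<kappa> * u / (8 * (D\<^sup>2 * ?\<Lambda>)) * (D\<^sup>2 * ?\<Lambda>)"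
      using D \<Lambda> by (intro mult_right_mono) (auto simp: \<theta>_def)
    then show "\<theta> * D\<^sup>2 * ?\<Lambda> \<le> \<kappa> * u / 8" using D \<Lambda> by (simp add: mult.assoc)
  qed
  define S where "S = 1 / h + (1 / \<epsilon> + 1) * ?\<Lambda>"
  have S: "0 < S" using h \<epsilon> \<Lambda> by (auto simp: S_def intro!: add_pos_pos mult_pos_pos)
  define \<delta> where "\<delta> = min \<epsilon> (min (u / 2) (\<kappa> * u / (8 * S)))"
  have \<delta>: "0 < \<delta>" "\<delta> \<le> \<epsilon>" "\<delta> \<le> u / 2" "\<delta> * S \<le> \<kappa> * u / 8"
  proof -
    show "0 < \<delta>" "\<delta> \<le> \<epsilon>" "\<delta> \<le> u / 2" using \<epsilon> pos S by (auto simp: \<delta>_def)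
    have "\<delta> * S \<le> \<kappa> * u / (8 * S) * S" using S by (intro mult_right_mono) (auto simp: \<delta>_def)
    then show "\<delta> * S \<le> \<kappa> * u / 8" using S by simp
  qed
  define c where "c = \<theta> * u"
  have c: "0 < c" using \<theta> pos by (simp add: c_def)
  \<comment> \<open>Where \<open>1 / N > \<delta>\<close>, this makes the claimed bound at least 1,
    the total mass.\<close>
  define b where "b = exp (c / \<delta>)"
  have b: "1 \<le> b" using c \<delta> by (simp add: b_def)
  show thesis
  proof (rule that[of b c])
    show "0 < b" using b by simp
    show "0 < c" by (rule c)
    fix N K p assume N: "1 \<le> N" and K: "\<alpha> * real N = real K" and st: "wip_stationary d Q0 Q1 N K p"
    let ?far = "{x. x \<in> configs d N \<and> R < l1_dist d (fractions N x) mstar}"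
    have fin: "finite (configs d N)" using st by (rule wip_stationary_finite)
    have p: "\<And>x. x \<in> configs d N \<Longrightarrow> 0 \<le> p x" "(\<Sum>x\<in>configs d N. p x) = 1"
      using st by (auto simp: wip_stationary_def)
    show "(\<Sum>x\<in>?far. p x) \<le> b * exp (- c * real N)"
    proof (cases "1 / real N \<le> \<delta>")
      case True
      have N1: "0 < real N" "1 \<le> real N" using N by auto
      have sq: "1 / (real N)\<^sup>2 \<le> 1 / real N"
        using N1 by (simp add: power2_eq_square field_simps)
      have "1 / (real N)\<^sup>2 / h + (1 / \<epsilon> + 1) * ?\<Lambda> / real N \<le> 1 / real N * S"
      proof -
        have "1 / (real N)\<^sup>2 / h \<le> 1 / real N / h" using sq h by (intro divide_right_mono) auto
        then show ?thesis by (simp add: S_def algebra_simps add_divide_distrib)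
      qed
      also have "\<dots> \<le> \<delta> * S" using True S by (intro mult_right_mono) auto
      finally have NS: "1 / (real N)\<^sup>2 / h + (1 / \<epsilon> + 1) * ?\<Lambda> / real N \<le> \<kappa> * u / 8"
        using \<delta> by linarith
      have "(\<Sum>x\<in>?far. p x) \<le> (\<Sum>x | x \<in> configs d N \<and> 3 * u \<le> V (fractions N x). p x)"
      proof (rule sum_mono2)
        show "?far \<subseteq> {x. x \<in> configs d N \<and> 3 * u \<le> V (fractions N x)}"
        proof clarsimp
          fix x assume "R < l1_dist d (fractions N x) mstar"
          then have "3 * u \<le> excess mstar (R / 2) (fractions N x)" unfolding excess_def u_def by linarith
          then show "3 * u \<le> V (fractions N x)"
            unfolding V_def using excess_le_max_excess order_trans by blast
        qed
      qed (use fin p in auto)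
      also have "\<dots> \<le> exp (- \<theta> * u * real N)"
      proof (rule E.stationary_tail[OF N _ K st \<theta>(1)])
        show "1 / (real N)\<^sup>2 \<le> \<epsilon>" using sq True \<delta> by linarith
        show "\<theta> * E.jump_bound \<le> 1" using \<theta> by (simp add: D_def)
        show "l * E.slope_bound * \<epsilon> + 1 / (real N)\<^sup>2 \<le> u"
          unfolding slope using \<epsilon>C sq True \<delta> by linarith
        show "(\<kappa> * l * E.slope_bound + 3 * ?\<Lambda> * E.slope_bound\<^sup>2) * \<epsilon> + h * ?\<Lambda>\<^sup>2 / (2 * \<epsilon>)
            + 1 / (real N)\<^sup>2 / h + (1 / \<epsilon> + 1) * ?\<Lambda> / real N + \<theta> * E.jump_bound\<^sup>2 * ?\<Lambda> \<le> \<kappa> * u / 2"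
          unfolding slope D_def[symmetric] A_def[symmetric] using \<epsilon>A hT NS \<theta>(3) by linarith
      qed
      also have "\<dots> = 1 * exp (- c * real N)" by (simp add: c_def)
      also have "\<dots> \<le> b * exp (- c * real N)" using b by (intro mult_right_mono) auto
      finally show ?thesis .
    next
      case False
      have "(\<Sum>x\<in>?far. p x) \<le> (\<Sum>x\<in>configs d N. p x)" using fin p by (intro sum_mono2) auto
      also have "\<dots> \<le> exp (c / \<delta> + - c * real N)"
      proof -
        have "real N * \<delta> \<le> 1" using False N by (simp add: field_simps)
        then have "real N \<le> 1 / \<delta>" using \<delta> by (simp add: field_simps)
        then have "c * real N \<le> c * (1 / \<delta>)" using c by (intro mult_left_mono) auto
        then show ?thesis using p(2) by simp
      qed
      also have "\<dots> = b * exp (- c * real N)" unfolding b_def exp_add ..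
      finally show ?thesis .
    qed
  qed
qed

end

section \<open>The stationary mean and the geometry of the simplex\<close>

lemma mean_M_eq: "mean_M d N p i = (\<Sum>x\<in>configs d N. p x * fractions N x i)"
  by (simp add: mean_M_def fractions_def)

text \<open>The linearised drift is bounded below only on directions into the simplex; this puts the
  direction of the mean among them.\<close>

lemma mean_M_in_bsimplex:
  assumes N: "1 \<le> N" and st: "wip_stationary d Q0 Q1 N K p"
  shows "mean_M d N p \<in> bsimplex d"
proof -
  have p: "\<And>x. x \<in> configs d N \<Longrightarrow> 0 \<le> p x" "(\<Sum>x\<in>configs d N. p x) = 1"
    using st by (auto simp: wip_stationary_def)
  have "(\<Sum>i<d. mean_M d N p i) = (\<Sum>x\<in>configs d N. p x * (\<Sum>i<d. fractions N x i))"
    unfolding mean_M_eq sum_distrib_left by (rule sum.swap)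
  also have "\<dots> = 1"
    using p(2) bsimplex_sum[OF fractions_in_bsimplex[OF _ N]] by simp
  finally show ?thesis
    using p(1) by (auto simp: bsimplex_def mean_M_eq fractions_def intro!: sum_nonneg)
qed

lemma bsimplex_l1_dist_le:
  assumes "m \<in> bsimplex d" "m' \<in> bsimplex d"
  shows "l1_dist d m m' \<le> 2"
proof -
  have "l1_dist d m m' \<le> (\<Sum>i<d. m i + m' i)"
    unfolding l1_dist_def
  proof (rule sum_mono)
    fix i assume "i \<in> {..<d}"
    then have "0 \<le> m i" "0 \<le> m' i" using assms bsimplex_nonneg by auto
    then show "\<bar>m i - m' i\<bar> \<le> m i + m' i" by linarith
  qed
  also have "\<dots> = 2" using assms by (simp add: sum.distrib bsimplex_def)
  finally show ?thesis .
qed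

text \<open>Rescaling stays inside the simplex even if \<open>ms\<close> lies on its boundary, because the coordinates
  in which \<open>ms\<close> vanishes can only increase.\<close>
lemma bsimplex_rescale:
  assumes ms: "ms \<in> bsimplex d"
  obtains \<sigma> where "0 < \<sigma>"
    and "\<And>m s. m \<in> bsimplex d \<Longrightarrow> 0 \<le> s \<Longrightarrow> s * l1_dist d m ms \<le> \<sigma> \<Longrightarrow> (\<lambda>i. ms i + s * (m i - ms i)) \<in> bsimplex d"
proof
  define A where "A = insert 1 (ms ` {i. i < d \<and> 0 < ms i})"
  have A: "finite A" "A \<noteq> {}" by (auto simp: A_def)
  show "0 < Min A" using A by (auto simp: A_def)
  fix m s assume m: "m \<in> bsimplex d" and s: "0 \<le> s" "s * l1_dist d m ms \<le> Min A"
  have "0 \<le> ms i + s * (m i - ms i)" if i: "i < d" for i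
  proof (cases "ms i = 0")
    case True
    then show ?thesis using s bsimplex_nonneg[OF m i] by simp
  next
    case False
    then have "ms i \<in> A" using bsimplex_nonneg[OF ms i] i by (auto simp: A_def)
    then have "Min A \<le> ms i" using A by (intro Min_le)
    then have "s * l1_dist d m ms \<le> ms i" using s by linarith
    moreover have "s * \<bar>m i - ms i\<bar> \<le> s * l1_dist d m ms"
      using s abs_diff_le_l1_dist[OF i] by (intro mult_left_mono)
    moreover have "- (s * \<bar>m i - ms i\<bar>) \<le> s * (m i - ms i)"
      using s mult_left_mono[of "- \<bar>m i - ms i\<bar>" "m i - ms i" s] by simp
    ultimately show ?thesis by linarith
  qed
  moreover have "(\<Sum>i<d. ms i + s * (m i - ms i)) = 1"
    using ms m by (simp add: bsimplex_def sum.distrib sum_subtractf flip: sum_distrib_left)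
  ultimately show "(\<lambda>i. ms i + s * (m i - ms i)) \<in> bsimplex d" by (simp add: bsimplex_def)
qed

section \<open>Linearisation at the equilibrium\<close>

context wip_bandit
begin

text \<open>Nonlinearity enters only through \<open>min S \<alpha>\<close> for partial sums
  \<open>S\<close>. At \<open>ms\<close> none of them equals \<alpha>, so within the smallest gap
  every minimum keeps its branch.\<close>

lemma drift_locally_affine:
  assumes nonsing: "\<not> singular d \<alpha> ms"
  obtains M \<rho> where "0 < \<rho>"
    and "\<And>m j. l1_dist d m ms \<le> \<rho> \<Longrightarrow> drift m j - drift ms j = (\<Sum>k<d. (m k - ms k) * M k j)"
proof -
  define A where "A = (\<lambda>n. \<bar>(\<Sum>k<n. ms k) - \<alpha>\<bar>) ` {..d}"
  have A: "finite A" "A \<noteq> {}" by (auto simp: A_def)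
  have "(\<Sum>k<n. ms k) \<noteq> \<alpha>" if "n \<le> d" for n
    using nonsing that alpha by (cases n) (auto simp: singular_def lessThan_Suc_atMost)
  then have \<rho>: "0 < Min A" using A by (auto simp: A_def)
  define below where "below n \<longleftrightarrow> (\<Sum>k<n. ms k) < \<alpha>" for n
  \<comment> \<open>The partial derivative of the active mass of \<open>i\<close> in coordinate
    \<open>k\<close>; \<open>M\<close> is then the Jacobian of the drift, acting on row
    vectors.\<close>
  define c :: "nat \<Rightarrow> nat \<Rightarrow> real"
    where "c i k = of_bool (below (Suc i) \<and> k < Suc i) - of_bool (below i \<and> k < i)" for i k
  define M where "M k j = (\<Sum>i<d. c i k * Q1 i j + (of_bool (k = i) - c i k) * Q0 i j)" for k j
  show thesis
  proof (rule that[OF \<rho>])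
    fix m j assume m: "l1_dist d m ms \<le> Min A"
    let ?v = "\<lambda>k. m k - ms k"
    have factor: "v * e * q1 + (v * e' - v * e) * q0 = v * (e * q1 + (e' - e) * q0)" for v e e' q0 q1 :: real
      by (simp add: algebra_simps)
    have min_affine: "min a \<alpha> - min b \<alpha> = (if b < \<alpha> then a - b else 0)" if "\<bar>a - b\<bar> \<le> \<bar>b - \<alpha>\<bar>" for a b
      using that by (auto simp: min_def)
    have part: "min (\<Sum>k<n. m k) \<alpha> - min (\<Sum>k<n. ms k) \<alpha> = (\<Sum>k<d. ?v k * of_bool (below n \<and> k < n))"
      if n: "n \<le> d" for n
    proof -
      have "\<bar>(\<Sum>k<n. ms k) - \<alpha>\<bar> \<in> A" using n by (auto simp: A_def)
      then have "Min A \<le> \<bar>(\<Sum>k<n. ms k) - \<alpha>\<bar>" using A by (intro Min_le)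
      then have near: "\<bar>(\<Sum>k<n. m k) - (\<Sum>k<n. ms k)\<bar> \<le> \<bar>(\<Sum>k<n. ms k) - \<alpha>\<bar>"
        using partial_sum_lipschitz[OF n, of m ms] m by linarith
      have "(\<Sum>k<d. ?v k * of_bool (below n \<and> k < n)) = (if below n then \<Sum>k<n. ?v k else 0)"
      proof (cases "below n")
        case True
        have "(\<Sum>k<n. ?v k) = (\<Sum>k<d. ?v k * of_bool (below n \<and> k < n))"
          using n True by (intro sum.mono_neutral_cong_left) auto
        then show ?thesis using True by simp
      qed simp
      moreover have "min (\<Sum>k<n. m k) \<alpha> - min (\<Sum>k<n. ms k) \<alpha>
          = (if below n then (\<Sum>k<n. m k) - (\<Sum>k<n. ms k) else 0)"
        unfolding below_def using near by (rule min_affine)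
      ultimately show ?thesis by (simp add: sum_subtractf)
    qed
    have act: "active_mass \<alpha> m i - active_mass \<alpha> ms i = (\<Sum>k<d. ?v k * c i k)" if i: "i < d" for i
    proof -
      have "(\<Sum>k<d. ?v k * c i k) = (\<Sum>k<d. ?v k * of_bool (below (Suc i) \<and> k < Suc i)) - (\<Sum>k<d. ?v k * of_bool (below i \<and> k < i))"
        by (simp only: c_def right_diff_distrib sum_subtractf)
      also have "\<dots> = active_mass \<alpha> m i - active_mass \<alpha> ms i"
        using part[of i] part[of "Suc i"] i unfolding active_mass_def by simp
      finally show ?thesis ..
    qed
    have id: "(\<Sum>k<d. ?v k * of_bool (k = i)) = ?v i" if "i < d" for i
    proof -
      have "(\<Sum>k<d. ?v k * of_bool (k = i)) = (\<Sum>k<d. if k = i then ?v k else 0)"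
        by (intro sum.cong) auto
      then show ?thesis using that by simp
    qed
    have "drift m j - drift ms j = (\<Sum>i<d. (active_mass \<alpha> m i - active_mass \<alpha> ms i) * Q1 i j
        + (?v i - (active_mass \<alpha> m i - active_mass \<alpha> ms i)) * Q0 i j)"
      unfolding drift_def sum_subtractf[symmetric] by (intro sum.cong) (auto simp: algebra_simps)
    also have "\<dots> = (\<Sum>i<d. (\<Sum>k<d. ?v k * c i k) * Q1 i j
        + ((\<Sum>k<d. ?v k * of_bool (k = i)) - (\<Sum>k<d. ?v k * c i k)) * Q0 i j)"
      by (intro sum.cong refl) (simp only: act id lessThan_iff)
    also have "\<dots> = (\<Sum>i<d. \<Sum>k<d. ?v k * (c i k * Q1 i j + (of_bool (k = i) - c i k) * Q0 i j))"
      unfolding sum_subtractf[symmetric] sum_distrib_right sum.distrib[symmetric]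
      by (intro sum.cong refl factor)
    also have "\<dots> = (\<Sum>k<d. \<Sum>i<d. ?v k * (c i k * Q1 i j + (of_bool (k = i) - c i k) * Q0 i j))"
      by (rule sum.swap)
    also have "\<dots> = (\<Sum>k<d. ?v k * M k j)" by (simp only: M_def sum_distrib_left)
    finally show "drift m j - drift ms j = (\<Sum>k<d. ?v k * M k j)" .
  qed
qed

text \<open>A start at distance \<open>\<sigma>\<close> from the equilibrium must travel at least \<open>\<sigma> / 2\<close> in bounded time, so its
  initial speed is bounded below; by linearity so is the linearised drift in every direction of the simplex.\<close>
lemma linearised_drift_injective:
  assumes attr: "uniform_global_attractor d Q0 Q1 \<alpha> ms" and ms: "ms \<in> bsimplex d"
    and equilibrium: "\<And>j. j < d \<Longrightarrow> drift ms j = 0" and \<rho>: "0 < \<rho>"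
    and affine: "\<And>m j. l1_dist d m ms \<le> \<rho> \<Longrightarrow> drift m j - drift ms j = (\<Sum>k<d. (m k - ms k) * M k j)"
  obtains c where "0 < c"
    and "\<And>m. m \<in> bsimplex d \<Longrightarrow> l1_dist d m ms \<le> c * (\<Sum>j<d. \<bar>\<Sum>k<d. (m k - ms k) * M k j\<bar>)"
proof -
  obtain \<sigma>0 where \<sigma>0: "0 < \<sigma>0"
    "\<And>m s. m \<in> bsimplex d \<Longrightarrow> 0 \<le> s \<Longrightarrow> s * l1_dist d m ms \<le> \<sigma>0 \<Longrightarrow> (\<lambda>i. ms i + s * (m i - ms i)) \<in> bsimplex d"
    by (rule bsimplex_rescale[OF ms]) (rule that)
  define \<sigma> where "\<sigma> = min \<rho> \<sigma>0"
  have \<sigma>: "0 < \<sigma>" "\<sigma> \<le> \<rho>" "\<sigma> \<le> \<sigma>0" using \<rho> \<sigma>0(1) by (auto simp: \<sigma>_def)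
  obtain T K where T: "0 < T"
    and reach: "\<And>k m. K \<le> k \<Longrightarrow> m \<in> bsimplex d \<Longrightarrow> l1_dist d (iter ((1/2) ^ k) (T * 2 ^ k) m) ms \<le> \<sigma> / 2"
    using euler_attraction[OF attr, of "\<sigma> / 2"] \<sigma> by auto
  \<comment> \<open>Moving by \<open>\<sigma> / 2\<close> within time \<open>T\<close> needs an
    initial speed of at least \<open>\<sigma> / c\<close>, by \<open>iter_move\<close>.\<close>
  define c where "c = 2 * real T * exp (3 * rate_bound * real T)"
  show thesis
  proof (rule that[of c])
    show "0 < c" using T by (simp add: c_def)
    fix m assume m: "m \<in> bsimplex d"
    let ?A = "\<Sum>j<d. \<bar>\<Sum>k<d. (m k - ms k) * M k j\<bar>"
    define D where "D = l1_dist d m ms"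
    show "l1_dist d m ms \<le> c * ?A"
    proof (cases "D = 0")
      case True
      then show ?thesis using \<open>0 < c\<close> by (simp add: D_def sum_nonneg)
    next
      case False
      then have D: "0 < D" using l1_dist_nonneg[of d m ms] by (simp add: D_def order_less_le)
      \<comment> \<open>Rescales the direction of \<open>m\<close> to length \<sigma>, where the
        drift is still exactly linear about \<open>ms\<close>.\<close>
      define s where "s = \<sigma> / D"
      have s: "0 < s" "s * D = \<sigma>" using D \<sigma> by (auto simp: s_def)
      define m0 where "m0 = (\<lambda>i. ms i + s * (m i - ms i))"
      have m0: "m0 \<in> bsimplex d"
        unfolding m0_def using s \<sigma> m by (intro \<sigma>0(2)) (auto simp: D_def)
      have dist: "l1_dist d m0 ms = \<sigma>"
        using s by (simp add: m0_def l1_dist_def D_def abs_mult flip: sum_distrib_left)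
      have speed: "l1_dist d (drift m0) (\<lambda>_. 0) = s * ?A"
      proof -
        have "drift m0 j = s * (\<Sum>k<d. (m k - ms k) * M k j)" if "j < d" for j
          using affine[of m0 j] equilibrium[OF that] dist \<sigma>
          by (simp add: m0_def sum_distrib_left mult.assoc)
        then have "l1_dist d (drift m0) (\<lambda>_. 0) = (\<Sum>j<d. s * \<bar>\<Sum>k<d. (m k - ms k) * M k j\<bar>)"
          unfolding l1_dist_def using s by (intro sum.cong) (simp_all add: abs_mult)
        then show ?thesis by (simp only: sum_distrib_left)
      qed
      define k where "k = max K min_level"
      have nh: "real (T * 2 ^ k) * (1/2) ^ k = real T" by (simp add: power_one_over)
      have "l1_dist d (iter ((1/2) ^ k) (T * 2 ^ k) m0) ms \<le> \<sigma> / 2"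
        using m0 by (intro reach) (auto simp: k_def)
      moreover have "l1_dist d (iter ((1/2) ^ k) (T * 2 ^ k) m0) m0 \<le> real T * exp (3 * rate_bound * real T) * (s * ?A)"
        using iter_move[OF m0 _ mesh_le_h0, of k "T * 2 ^ k"] unfolding nh speed by (simp add: k_def)
      ultimately have "\<sigma> \<le> \<sigma> / 2 + real T * exp (3 * rate_bound * real T) * (s * ?A)"
        using l1_dist_triangle[of d m0 ms "iter ((1/2) ^ k) (T * 2 ^ k) m0"] dist
        by (simp add: l1_dist_commute[of d m0])
      then have "s * D \<le> s * (c * ?A)" using s(2) by (simp add: c_def mult_ac)
      then show ?thesis using s(1) by (simp add: D_def)
    qed
  qed
qed

end

theorem mainTheorem11:
  fixes d :: nat and Q0 Q1 :: "nat \<Rightarrow> nat \<Rightarrow> real" and R0 R1 :: "nat \<Rightarrow> real"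
    and \<alpha> :: real and mstar :: "nat \<Rightarrow> real"
  assumes gen0: "is_generator d Q0" and gen1: "is_generator d Q1"
    and alpha: "0 < \<alpha>" "\<alpha> < 1"
    and uni: "unichain d Q0 Q1"
    and idx: "strictly_indexable d Q0 Q1 R0 R1"
    and order: "\<forall>i j. i < j \<and> j < d \<longrightarrow> whittle_index d Q0 Q1 R0 R1 j < whittle_index d Q0 Q1 R0 R1 i"
    and fix_in: "mstar \<in> bsimplex d"
    and fix_eq: "\<forall>j<d. phi d Q0 Q1 \<alpha> mstar j = mstar j"
    and fix_uniq: "\<forall>m\<in>bsimplex d. (\<forall>j<d. phi d Q0 Q1 \<alpha> m j = m j) \<longrightarrow> (\<forall>j<d. m j = mstar j)"
    and attr: "uniform_global_attractor d Q0 Q1 \<alpha> mstar"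
    and nonsing: "\<not> singular d \<alpha> mstar"
  shows "\<exists>b>0. \<exists>c>0. \<forall>N K p. 1 \<le> N \<longrightarrow> \<alpha> * real N = real K \<longrightarrow> wip_stationary d Q0 Q1 N K p \<longrightarrow>
           (\<forall>i<d. \<bar>mean_M d N p i - mstar i\<bar> \<le> b * exp (- c * real N))"
proof -
  interpret wip_bandit d Q0 Q1 \<alpha> using gen0 gen1 alpha by unfold_locales
  have equilibrium: "drift mstar j = 0" if "j < d" for j
    using drift_eq_phi[OF fix_in that] fix_eq that by simp
  obtain M \<rho> where \<rho>: "0 < \<rho>"
    and affine: "\<And>m j. l1_dist d m mstar \<le> \<rho> \<Longrightarrow> drift m j - drift mstar j = (\<Sum>k<d. (m k - mstar k) * M k j)"
    by (rule drift_locally_affine[OF nonsing]) (rule that)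
  obtain c1 where c1: "0 < c1"
    and inj: "\<And>m. m \<in> bsimplex d \<Longrightarrow> l1_dist d m mstar \<le> c1 * (\<Sum>j<d. \<bar>\<Sum>k<d. (m k - mstar k) * M k j\<bar>)"
    by (rule linearised_drift_injective[OF attr fix_in equilibrium \<rho> affine]) (assumption | rule that)+
  obtain b c where b: "0 < b" and c: "0 < c"
    and conc: "\<And>N K p. 1 \<le> N \<Longrightarrow> \<alpha> * real N = real K \<Longrightarrow> wip_stationary d Q0 Q1 N K p \<Longrightarrow>
      (\<Sum>x | x \<in> configs d N \<and> \<rho> < l1_dist d (fractions N x) mstar. p x) \<le> b * exp (- c * real N)"
    by (rule stationary_concentration[OF attr \<rho>]) (rule that)
  define B where "B = 2 * (\<Sum>k<d. \<Sum>j<d. \<bar>M k j\<bar>) + rate_bound"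
  have B: "0 < B" using rate_bound_pos by (auto simp: B_def intro!: add_nonneg_pos sum_nonneg)
  have lin_bound: "\<bar>(\<Sum>k<d. (m k - mstar k) * M k j) - drift m j\<bar> \<le> B" if m: "m \<in> bsimplex d" and j: "j < d" for m j
  proof -
    have "\<bar>\<Sum>k<d. (m k - mstar k) * M k j\<bar> \<le> (\<Sum>k<d. \<bar>m k - mstar k\<bar> * \<bar>M k j\<bar>)"
      unfolding abs_mult[symmetric] by (rule sum_abs)
    also have "\<dots> \<le> (\<Sum>k<d. 2 * (\<Sum>j<d. \<bar>M k j\<bar>))"
    proof (intro sum_mono mult_mono)
      fix k assume k: "k \<in> {..<d}"
      show "\<bar>m k - mstar k\<bar> \<le> 2"
        using abs_diff_le_l1_dist[of k d m mstar] bsimplex_l1_dist_le[OF m fix_in] k by simp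
      show "\<bar>M k j\<bar> \<le> (\<Sum>j<d. \<bar>M k j\<bar>)" using j by (intro member_le_sum) auto
    qed (auto simp: sum_nonneg)
    finally have "\<bar>\<Sum>k<d. (m k - mstar k) * M k j\<bar> \<le> 2 * (\<Sum>k<d. \<Sum>j<d. \<bar>M k j\<bar>)"
      by (simp add: sum_distrib_left)
    moreover have "\<bar>drift m j\<bar> \<le> rate_bound"
      using abs_diff_le_l1_dist[OF j, of "drift m" "\<lambda>_. 0"] drift_bounded[OF m] by simp
    ultimately show ?thesis unfolding B_def by linarith
  qed
  define b' where "b' = c1 * (real d * (B * b))"
  have "0 < b'" using c1 B b bsimplex_dim_pos[OF fix_in] by (simp add: b'_def)
  moreover have "\<bar>mean_M d N p i - mstar i\<bar> \<le> b' * exp (- c * real N)"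
    if N: "1 \<le> N" and K: "\<alpha> * real N = real K" and st: "wip_stationary d Q0 Q1 N K p" and i: "i < d"
    for N K p i
  proof -
    let ?C = "configs d N"
    let ?far = "{x. x \<in> ?C \<and> \<rho> < l1_dist d (fractions N x) mstar}"
    let ?lin = "\<lambda>x j. \<Sum>k<d. (fractions N x k - mstar k) * M k j"
    have fin: "finite ?C" using st by (rule wip_stationary_finite)
    have p: "\<And>x. x \<in> ?C \<Longrightarrow> 0 \<le> p x" "(\<Sum>x\<in>?C. p x) = 1"
      using st by (auto simp: wip_stationary_def)
    have "\<bar>\<Sum>k<d. (mean_M d N p k - mstar k) * M k j\<bar> \<le> B * (b * exp (- c * real N))" if j: "j < d" for j
    proof -
      have "mean_M d N p k - mstar k = (\<Sum>x\<in>?C. p x * (fractions N x k - mstar k))" for k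
        using p(2) by (simp add: mean_M_eq right_diff_distrib sum_subtractf flip: sum_distrib_right)
      then have "(\<Sum>k<d. (mean_M d N p k - mstar k) * M k j) = (\<Sum>k<d. \<Sum>x\<in>?C. p x * ((fractions N x k - mstar k) * M k j))"
        by (simp add: sum_distrib_right mult.assoc)
      also have "\<dots> = (\<Sum>x\<in>?C. p x * ?lin x j)"
        unfolding sum_distrib_left by (rule sum.swap)
      \<comment> \<open>The drift has stationary mean 0, so subtracting it changes nothing, but
        every summand from the ball of radius \<rho> now vanishes.\<close>
      also have "\<dots> = (\<Sum>x\<in>?C. p x * (?lin x j - drift (fractions N x) j))"
        using stationary_mean_drift[OF N K st j] by (simp add: right_diff_distrib sum_subtractf)
      also have "\<dots> = (\<Sum>x\<in>?far. p x * (?lin x j - drift (fractions N x) j))"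
      proof (rule sum.mono_neutral_right)
        show "\<forall>x\<in>?C - ?far. p x * (?lin x j - drift (fractions N x) j) = 0"
        proof
          fix x assume "x \<in> ?C - ?far"
          then have "l1_dist d (fractions N x) mstar \<le> \<rho>" by auto
          then have "?lin x j - drift (fractions N x) j = 0"
            using affine[of "fractions N x" j] equilibrium[OF j] by simp
          then show "p x * (?lin x j - drift (fractions N x) j) = 0" by simp
        qed
      qed (use fin in auto)
      finally have "\<bar>\<Sum>k<d. (mean_M d N p k - mstar k) * M k j\<bar>
          \<le> (\<Sum>x\<in>?far. \<bar>p x * (?lin x j - drift (fractions N x) j)\<bar>)"
        by (simp only: sum_abs)
      also have "\<dots> \<le> (\<Sum>x\<in>?far. B * p x)"
      proof (rule sum_mono)
        fix x assume x: "x \<in> ?far"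
        have "p x * \<bar>?lin x j - drift (fractions N x) j\<bar> \<le> p x * B"
          using x p(1) lin_bound[OF fractions_in_bsimplex[OF _ N] j] by (intro mult_left_mono) auto
        then show "\<bar>p x * (?lin x j - drift (fractions N x) j)\<bar> \<le> B * p x"
          using x p(1) by (simp add: abs_mult mult.commute)
      qed
      also have "\<dots> = B * (\<Sum>x\<in>?far. p x)" by (simp only: sum_distrib_left)
      also have "\<dots> \<le> B * (b * exp (- c * real N))"
        using conc[OF N K st] B by (intro mult_left_mono) auto
      finally show ?thesis .
    qed
    then have "(\<Sum>j<d. \<bar>\<Sum>k<d. (mean_M d N p k - mstar k) * M k j\<bar>) \<le> real d * (B * (b * exp (- c * real N)))"
      using sum_mono[of "{..<d}" "\<lambda>j. \<bar>\<Sum>k<d. (mean_M d N p k - mstar k) * M k j\<bar>" "\<lambda>_. B * (b * exp (- c * real N))"]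
      by simp
    then have "c1 * (\<Sum>j<d. \<bar>\<Sum>k<d. (mean_M d N p k - mstar k) * M k j\<bar>) \<le> c1 * (real d * (B * (b * exp (- c * real N))))"
      using c1 by (intro mult_left_mono) auto
    moreover have "\<bar>mean_M d N p i - mstar i\<bar> \<le> l1_dist d (mean_M d N p) mstar"
      using i by (rule abs_diff_le_l1_dist)
    ultimately show ?thesis
      using inj[OF mean_M_in_bsimplex[OF N st]] by (simp add: b'_def mult_ac)
  qed
  ultimately show ?thesis using c by blast
qed

end
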